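(* Let $x>0$ and let $k\in(0,1)$ be the unique modulus with $x=K(k')/K(k)$. Then $$2\sum_{n=1}^\infty \frac{n^2\cosh(\pi n x)}{\sinh^2(\pi n x)}=\sum_{n=1}^\infty \frac{(2n-1)\cosh(\pi(2n-1)x/2)}{\sinh^3(\pi(2n-1)x/2)}=\frac{4}{\pi^4}K^2(k)\Big[k^2K^2(k)-\big(K(k)-E(k)\big)^2\Big].$$
   Context: For $k\in(0,1)$ let $k'=\sqrt{1-k^2}$, and let $K(k)=\int_0^1\frac{dt}{\sqrt{(1-t^2)(1-k^2t^2)}}$ and $E(k)=\int_0^1\sqrt{\frac{1-k^2t^2}{1-t^2}}\,dt$ be the complete elliptic integrals of the first and second kind. The map $k\mapsto x(k)=K(k')/K(k)$ is a strictly decreasing continuously differentiable bijection from $(0,1)$ onto $(0,\infty)$, so each $x>0$ determines a unique $k\in(0,1)$ with $x(k)=x$. *)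

theory Defs
  imports "HOL-Analysis.Analysis"
begin

text \<open>Complete elliptic integrals of the first and second kind, as (Lebesgue/HK) integrals
over [0,1]; the integrands are absolutely integrable for 0 < k < 1.\<close>

definition ellK :: "real \<Rightarrow> real" where
  "ellK k = integral {0..1} (\<lambda>t. 1 / sqrt ((1 - t\<^sup>2) * (1 - k\<^sup>2 * t\<^sup>2)))"

definition ellE :: "real \<Rightarrow> real" where
  "ellE k = integral {0..1} (\<lambda>t. sqrt ((1 - k\<^sup>2 * t\<^sup>2) / (1 - t\<^sup>2)))"

definition compl_modulus :: "real \<Rightarrow> real" where
  "compl_modulus k = sqrt (1 - k\<^sup>2)"

end

theory Submission
  imports Defs
begin

text \<open>Differentiating \<open>log (theta4 x) = \<Sum>n. ln (tanh (pi n x / 2))\<close>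
  (Gauss's product) twice in \<open>x\<close> gives \<open>- pi\<^sup>2\<close> times the first series. On the other hand
  \<open>theta4\<^sup>2 = 2 k' K / pi\<close>, so by the chain rule along \<open>k \<mapsto> K(k') / K(k)\<close>, whose derivative
  \<open>- pi / (2 k k'\<^sup>2 K\<^sup>2)\<close> comes from the Legendre relation, the first derivative is
  \<open>K (K - E) / pi\<close> and the second yields the closed form.

  The link between theta functions and elliptic integrals is the arithmetic-geometric mean:
  under \<open>x \<mapsto> 2 x\<close> the pair \<open>(theta3\<^sup>2, theta4\<^sup>2)\<close> performs one AGM step and
  \<open>(theta3\<^sup>2, theta2\<^sup>2)\<close> undoes one, while the integral of
  \<open>1 / sqrt ((t\<^sup>2 + a\<^sup>2) (t\<^sup>2 + b\<^sup>2))\<close> over the positive half-line is invariant. Letting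
  \<open>x \<rightarrow> \<infinity>\<close> along \<open>2\<^sup>n x\<close> identifies \<open>K\<close> and \<open>K'\<close> for the modulus \<open>theta2\<^sup>2 / theta3\<^sup>2\<close>.\<close>

section \<open>Theta series\<close>

text \<open>Both differentiations are carried out in the modulus k, not in x. A function of x
  composed with k |-> K(k')/K(k) has one derivative from the chain rule and another from its
  expression in K and E; uniqueness of derivatives equates them. The inverse map x |-> k is thus
  never formed: a given k is recognised as the theta quotient because the ratio is injective. K' is
  usually found from the transformation x |-> 1/x of the theta functions. Here growth takes its
  place: the integral belonging to K' doubles whenever x doubles, so its quotient by x is determined
  by the limit at infinity. That limit is read off from the logarithmic growth ln (1/b) of the
  integral with parameters 1 and b, because b = theta2^2 / theta3^2 decays like 4 exp (- pi x / 2).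
  The equality of the two series is independent of elliptic integrals. It is an interchange of
  summation in a nonnegative double series, whose convergence is inherited from the termwise
  differentiation.\<close>

lemma has_sum_product_real:
  fixes f :: "'a \<Rightarrow> real" and g :: "'b \<Rightarrow> real"
  assumes "(f has_sum a) A" "(g has_sum b) B"
  shows "((\<lambda>(x, y). f x * g y) has_sum (a * b)) (A \<times> B)"
proof -
  \<comment> \<open>Summable real families are absolutely summable, which is what the Fubini
    argument requires.\<close>
  have f: "(\<lambda>x. norm (f x)) summable_on A" and g: "(\<lambda>y. norm (g y)) summable_on B"
    using assms using summable_on_iff_abs_summable_on_real has_sum_imp_summable by blast+
  have "(\<lambda>p. norm (f (fst p) * g (snd p))) summable_on (A \<times> B)"
    unfolding Infinite_Sum.abs_summable_on_Sigma_iff fst_conv snd_conv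
    unfolding norm_mult
  proof (intro conjI ballI)
    show "(\<lambda>y. norm (f x) * norm (g y)) summable_on B" for x
      by (intro summable_on_cmult_right g)
    have "(\<lambda>x. norm (f x) * (\<Sum>\<^sub>\<infinity>y\<in>B. norm (g y))) summable_on A"
      by (intro summable_on_cmult_left f)
    then show "(\<lambda>x. norm (\<Sum>\<^sub>\<infinity>y\<in>B. norm (f x) * norm (g y))) summable_on A"
      by (simp add: infsum_cmult_right' abs_mult infsum_nonneg)
  qed
  then have s: "(\<lambda>(x, y). f x * g y) summable_on A \<times> B"
    unfolding case_prod_unfold by (rule Infinite_Sum.abs_summable_summable)
  have "infsum (\<lambda>(x, y). f x * g y) (A \<times> B) = (\<Sum>\<^sub>\<infinity>x\<in>A. \<Sum>\<^sub>\<infinity>y\<in>B. f x * g y)"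
    using infsum_Sigma'_banach [OF s] by simp
  also have "\<dots> = a * b"
    using assms by (simp add: infsum_cmult_right' infsum_cmult_left' infsumI)
  finally show ?thesis
    using s by (simp add: has_sum_iff)
qed

text \<open>Both families together enumerate \<open>\<int> \<times> \<int>\<close>: pairs whose coordinates have equal
  respectively opposite parity.\<close>

lemma has_sum_int_rotate:
  fixes F :: "int \<Rightarrow> int \<Rightarrow> real"
  assumes F: "((\<lambda>(m, n). F m n) has_sum s) UNIV"
    and G: "((\<lambda>(a, b). F (a + b) (a - b)) has_sum s1) UNIV"
    and H: "((\<lambda>(a, b). F (a + b + 1) (a - b)) has_sum s2) UNIV"
  shows "s = s1 + s2"
proof -
  let ?E = "{p :: int \<times> int. even (fst p + snd p)}"
  let ?O = "{p :: int \<times> int. odd (fst p + snd p)}"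
  have 1: "((\<lambda>(m, n). F m n) has_sum s1) ?E"
  proof -
    let ?h = "\<lambda>(a, b). (a + b, a - b) :: int \<times> int"
    have "inj ?h" by (auto intro!: injI)
    moreover have "(m, n) \<in> range ?h" if "even (m + n)" for m n
    proof -
      obtain k where "m + n = 2 * k" using \<open>even (m + n)\<close> by (rule evenE)
      then have "(m, n) = ?h (k, m - k)" by simp
      then show ?thesis by blast
    qed
    then have "?E = range ?h" by auto
    ultimately show ?thesis
      using G by (simp only: has_sum_reindex) (simp add: o_def case_prod_unfold)
  qed
  have 2: "((\<lambda>(m, n). F m n) has_sum s2) ?O"
  proof -
    let ?h = "\<lambda>(a, b). (a + b + 1, a - b) :: int \<times> int"
    have "inj ?h" by (auto intro!: injI)
    moreover have "(m, n) \<in> range ?h" if "odd (m + n)" for m n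
    proof -
      obtain k where "m + n = 2 * k + 1" using \<open>odd (m + n)\<close> by (rule oddE)
      then have "(m, n) = ?h (k, m - k - 1)" by simp
      then show ?thesis by blast
    qed
    then have "?O = range ?h" by auto
    ultimately show ?thesis
      using H by (simp only: has_sum_reindex) (simp add: o_def case_prod_unfold)
  qed
  have "((\<lambda>(m, n). F m n) has_sum (s1 + s2)) (?E \<union> ?O)"
    by (rule has_sum_Un_disjoint [OF 1 2]) auto
  moreover have "?E \<union> ?O = UNIV" by auto
  ultimately show ?thesis
    using F has_sum_unique by metis
qed

section \<open>Theta constants: convergence, bounds and duplication formulas\<close>

definition theta2 :: "real \<Rightarrow> real" where
  "theta2 x = (\<Sum>\<^sub>\<infinity>n::int. exp (- pi * x * (of_int n + 1/2)\<^sup>2))"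

definition theta3 :: "real \<Rightarrow> real" where
  "theta3 x = (\<Sum>\<^sub>\<infinity>n::int. exp (- pi * x * (of_int n)\<^sup>2))"

definition theta4 :: "real \<Rightarrow> real" where
  "theta4 x = (\<Sum>\<^sub>\<infinity>n::int. (if even n then 1 else - 1) * exp (- pi * x * (of_int n)\<^sup>2))"

text \<open>Negative indices are written - n - 1, so that 0 is not counted twice and the shifted
  squares (n + 1/2)^2 of \<open>theta2\<close> take the same values on both halves.\<close>

lemma has_sum_int_UNIV:
  fixes f :: "int \<Rightarrow> real"
  assumes "((\<lambda>n. f (int n)) has_sum a) UNIV" "((\<lambda>n. f (- int n - 1)) has_sum b) UNIV"
  shows "(f has_sum (a + b)) UNIV"
proof -
  have "(f has_sum a) {0..}"
    using assms(1) by (rule has_sum_reindex_bij_witness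
        [where j = int and i = nat, THEN iffD1, rotated -1]) auto
  moreover have "(f has_sum b) {..<0}"
    using assms(2) by (rule has_sum_reindex_bij_witness
        [where j = "\<lambda>n. - int n - 1" and i = "\<lambda>n. nat (- n - 1)", THEN iffD1, rotated -1]) auto
  ultimately have "(f has_sum (a + b)) ({0..} \<union> {..<0})"
    by (rule has_sum_Un_disjoint) auto
  moreover have "{0..} \<union> {..<0} = (UNIV :: int set)" by auto
  ultimately show ?thesis by simp
qed

text \<open>Since n^2 >= n, the quadratic exponents are dominated by linear ones, and geometric
  series in the nome exp (- pi x) majorise the theta series.\<close>

lemma exp_quadratic_le:
  fixes x :: real
  assumes "x > 0"
  shows "exp (- pi * x * (of_nat n)\<^sup>2) \<le> exp (- pi * x) ^ n"
    and "exp (- pi * x * (of_nat n + 1/2)\<^sup>2) \<le> exp (- pi * x / 4) * exp (- pi * x) ^ n"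
    and "exp (- pi * x * (of_nat n + 1)\<^sup>2) \<le> exp (- pi * x) * exp (- pi * x) ^ n"
proof -
  have *: "(of_nat n)\<^sup>2 \<ge> (of_nat n :: real)"
    by (cases n) (auto simp: power2_eq_square)
  have **: "exp (- pi * x) ^ n = exp (- pi * x * of_nat n)"
    by (simp add: exp_of_nat_mult [symmetric] mult_ac)
  have mono: "- pi * x * b \<le> - pi * x * a" if "a \<le> b" for a b
    using assms that by simp
  show "exp (- pi * x * (of_nat n)\<^sup>2) \<le> exp (- pi * x) ^ n"
    unfolding ** using mono [OF *] by simp
  have "exp (- pi * x * (of_nat n + 1/2)\<^sup>2) \<le> exp (- pi * x * (1 / 4 + of_nat n))"
    unfolding exp_le_cancel_iff by (rule mono) (use * in \<open>simp add: power2_eq_square algebra_simps\<close>)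
  then show "exp (- pi * x * (of_nat n + 1/2)\<^sup>2) \<le> exp (- pi * x / 4) * exp (- pi * x) ^ n"
    unfolding ** exp_add [symmetric] by (simp add: algebra_simps)
  have "exp (- pi * x * (of_nat n + 1)\<^sup>2) \<le> exp (- pi * x * (1 + of_nat n))"
    unfolding exp_le_cancel_iff by (rule mono) (use * in \<open>simp add: power2_eq_square algebra_simps\<close>)
  then show "exp (- pi * x * (of_nat n + 1)\<^sup>2) \<le> exp (- pi * x) * exp (- pi * x) ^ n"
    unfolding ** exp_add [symmetric] by (simp add: algebra_simps)
qed

lemma has_sum_geometric_real:
  fixes r :: real
  assumes "0 \<le> r" "r < 1"
  shows "((\<lambda>n. r ^ n) has_sum (1 / (1 - r))) UNIV"
  using assms by (intro sums_nonneg_imp_has_sum geometric_sums) auto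

context
  fixes x :: real
  assumes x: "x > 0"
begin

lemma nome_less_1: "exp (- pi * x) < 1"
  using x by simp

text \<open>The lower bound is the term n = 0, the upper one the sum of the geometric majorants of
  both halves. The two meet at 1 as x tends to infinity.\<close>

lemma theta3_bounds_has_sum:
  shows theta3_has_sum: "((\<lambda>n::int. exp (- pi * x * (of_int n)\<^sup>2)) has_sum theta3 x) UNIV"
    and theta3_ge_1: "theta3 x \<ge> 1"
    and theta3_le: "theta3 x \<le> (1 + exp (- pi * x)) / (1 - exp (- pi * x))"
proof -
  let ?q = "exp (- pi * x)"
  have geo: "((\<lambda>n. ?q ^ n) has_sum (1 / (1 - ?q))) UNIV"
    by (rule has_sum_geometric_real) (rule exp_ge_zero nome_less_1)+
  have 1: "(\<lambda>n. exp (- pi * x * (of_nat n)\<^sup>2)) summable_on (UNIV :: nat set)"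
    by (rule summable_on_comparison_test [OF has_sum_imp_summable [OF geo]])
       (rule exp_quadratic_le(1) [OF x] exp_ge_zero)+
  have 2: "(\<lambda>n. exp (- pi * x * (of_nat n + 1)\<^sup>2)) summable_on (UNIV :: nat set)"
    by (rule summable_on_comparison_test [OF has_sum_imp_summable [OF has_sum_cmult_right [OF geo]]])
       (rule exp_quadratic_le(3) [OF x] exp_ge_zero)+
  obtain a b where a: "((\<lambda>n. exp (- pi * x * (of_nat n)\<^sup>2)) has_sum a) (UNIV :: nat set)"
    and b: "((\<lambda>n. exp (- pi * x * (of_nat n + 1)\<^sup>2)) has_sum b) (UNIV :: nat set)"
    using 1 2 unfolding summable_on_def by blast
  have sq: "(of_int (- int n - 1))\<^sup>2 = (of_nat n + 1 :: real)\<^sup>2" for n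
    by (simp add: power2_eq_square algebra_simps)
  have ab: "((\<lambda>n::int. exp (- pi * x * (of_int n)\<^sup>2)) has_sum (a + b)) UNIV"
    by (rule has_sum_int_UNIV) (unfold sq of_int_of_nat_eq, (rule a b)+)
  then have eq: "theta3 x = a + b"
    unfolding theta3_def by (rule infsumI)
  show "((\<lambda>n::int. exp (- pi * x * (of_int n)\<^sup>2)) has_sum theta3 x) UNIV"
    using ab eq by simp
  have "1 \<le> theta3 x"
    using finite_sum_le_has_sum [OF ab, of "{0}"] eq by simp
  then show "theta3 x \<ge> 1" .
  have "a \<le> 1 / (1 - ?q)"
    by (rule has_sum_mono [OF a geo]) (rule exp_quadratic_le(1) [OF x] exp_ge_zero)+
  moreover have "b \<le> ?q * (1 / (1 - ?q))"
    by (rule has_sum_mono [OF b has_sum_cmult_right [OF geo]]) (rule exp_quadratic_le(3) [OF x] exp_ge_zero)+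
  ultimately show "theta3 x \<le> (1 + ?q) / (1 - ?q)"
    using eq by (simp add: add_divide_distrib)
qed

text \<open>Both halves of the index set contribute equally. The indices 0 and - 1 give the leading
  term 2 exp (- pi x / 4), and the geometric majorant costs only a factor tending to 1.\<close>

lemma theta2_bounds_has_sum:
  shows theta2_has_sum: "((\<lambda>n::int. exp (- pi * x * (of_int n + 1/2)\<^sup>2)) has_sum theta2 x) UNIV"
    and theta2_ge: "theta2 x \<ge> 2 * exp (- pi * x / 4)"
    and theta2_le: "theta2 x \<le> 2 * exp (- pi * x / 4) / (1 - exp (- pi * x))"
proof -
  let ?q = "exp (- pi * x)" and ?r = "exp (- pi * x / 4)"
  have geo: "((\<lambda>n. ?r * ?q ^ n) has_sum (?r * (1 / (1 - ?q)))) UNIV"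
    by (rule has_sum_cmult_right, rule has_sum_geometric_real) (rule exp_ge_zero nome_less_1)+
  have "(\<lambda>n. exp (- pi * x * (of_nat n + 1/2)\<^sup>2)) summable_on (UNIV :: nat set)"
    by (rule summable_on_comparison_test [OF has_sum_imp_summable [OF geo]])
       (rule exp_quadratic_le(2) [OF x] exp_ge_zero)+
  then obtain a where a: "((\<lambda>n. exp (- pi * x * (of_nat n + 1/2)\<^sup>2)) has_sum a) (UNIV :: nat set)"
    unfolding summable_on_def by blast
  have sq: "(of_int (- int n - 1) + 1/2)\<^sup>2 = (of_nat n + 1/2 :: real)\<^sup>2" for n
    by (simp add: power2_eq_square algebra_simps)
  have ab: "((\<lambda>n::int. exp (- pi * x * (of_int n + 1/2)\<^sup>2)) has_sum (a + a)) UNIV"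
    by (rule has_sum_int_UNIV) (unfold sq of_int_of_nat_eq, (rule a)+)
  then have eq: "theta2 x = a + a"
    unfolding theta2_def by (rule infsumI)
  show "((\<lambda>n::int. exp (- pi * x * (of_int n + 1/2)\<^sup>2)) has_sum theta2 x) UNIV"
    using ab eq by simp
  have "a \<ge> ?r"
    using finite_sum_le_has_sum [OF a, of "{0}"] by (simp add: power2_eq_square)
  then show "theta2 x \<ge> 2 * ?r" using eq by simp
  have "a \<le> ?r * (1 / (1 - ?q))"
    by (rule has_sum_mono [OF a geo]) (rule exp_quadratic_le(2) [OF x] exp_ge_zero)+
  then show "theta2 x \<le> 2 * ?r / (1 - ?q)"
    using eq by simp
qed

lemma theta4_has_sum:
  "((\<lambda>n::int. (if even n then 1 else - 1) * exp (- pi * x * (of_int n)\<^sup>2)) has_sum theta4 x) UNIV"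
proof -
  have "(\<lambda>n::int. norm ((if even n then 1 else - 1) * exp (- pi * x * (of_int n)\<^sup>2))) summable_on UNIV"
  proof -
    have *: "norm ((if even n then 1 else - 1) * exp r) = exp r" for n :: int and r :: real
      by (cases "even n") simp_all
    show ?thesis
      unfolding * by (rule has_sum_imp_summable [OF theta3_has_sum])
  qed
  then show ?thesis
    unfolding theta4_def by (rule has_sum_infsum [OF Infinite_Sum.abs_summable_summable])
qed

end

text \<open>The rotation m = a + b, n = a - b turns m^2 + n^2 into 2 (a^2 + b^2), whence the
  argument 2 x; pairs of opposite parity lead to a + 1/2 and b + 1/2 instead. In the square of
  \<open>theta4\<close> the sign (-1)^(m + n) is constant on each parity class and turns the plus
  into a minus. In the square of \<open>theta2\<close> each class yields one product of
  \<open>theta2\<close> and \<open>theta3\<close>.\<close>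

lemma theta_squares:
  assumes x: "x > 0"
  shows theta3_square: "(theta3 x)\<^sup>2 = (theta3 (2 * x))\<^sup>2 + (theta2 (2 * x))\<^sup>2"
    and theta4_square: "(theta4 x)\<^sup>2 = (theta3 (2 * x))\<^sup>2 - (theta2 (2 * x))\<^sup>2"
    and theta2_square: "(theta2 x)\<^sup>2 = 2 * theta2 (2 * x) * theta3 (2 * x)"
proof -
  have x2: "2 * x > 0" using x by simp
  define e where "e r = exp (- pi * x * r\<^sup>2)" for r :: real
  define E where "E r = exp (- pi * (2 * x) * r\<^sup>2)" for r :: real
  define sg where "sg n = (if even n then 1 else - 1 :: real)" for n :: int
  note t3 = theta3_has_sum [OF x, folded e_def] and t2 = theta2_has_sum [OF x, folded e_def]
    and t4 = theta4_has_sum [OF x, folded e_def sg_def]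
  note T3 = theta3_has_sum [OF x2, folded E_def] and T2 = theta2_has_sum [OF x2, folded E_def]
  note prod = has_sum_product_real [where A = UNIV and B = UNIV, unfolded UNIV_Times_UNIV]
  \<comment> \<open>In \<open>e4\<close> the opposite-parity class produces the
    \<open>theta3\<close> series with its index shifted by one.\<close>
  have T3': "((\<lambda>n::int. E (of_int n + 1)) has_sum theta3 (2 * x)) UNIV"
    using T3 by (rule has_sum_reindex_bij_witness
        [where j = "\<lambda>n. n + 1" and i = "\<lambda>n. n - 1", THEN iffD2, rotated -1]) auto
  have e: "e r * e s = E u * E v" if "r\<^sup>2 + s\<^sup>2 = 2 * (u\<^sup>2 + v\<^sup>2)" for r s u v
  proof -
    have "- pi * x * r\<^sup>2 + - pi * x * s\<^sup>2 = - pi * x * (r\<^sup>2 + s\<^sup>2)"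
      by (simp only: distrib_left)
    also have "\<dots> = - pi * (2 * x) * u\<^sup>2 + - pi * (2 * x) * v\<^sup>2"
      unfolding that by (simp add: algebra_simps)
    finally show ?thesis unfolding e_def E_def mult_exp_exp by simp
  qed
  have e1: "e (of_int (a + b)) * e (of_int (a - b)) = E (of_int a) * E (of_int b)" for a b
    by (rule e) (simp add: power2_eq_square algebra_simps)
  have e2: "e (of_int (a + b + 1)) * e (of_int (a - b)) = E (of_int a + 1/2) * E (of_int b + 1/2)" for a b
    by (rule e) (simp add: power2_eq_square algebra_simps)
  have e3: "e (of_int (a + b) + 1/2) * e (of_int (a - b) + 1/2) = E (of_int a + 1/2) * E (of_int b)" for a b
    by (rule e) (simp add: power2_eq_square algebra_simps)
  have e4: "e (of_int (a + b + 1) + 1/2) * e (of_int (a - b) + 1/2) = E (of_int a + 1) * E (of_int b + 1/2)" for a b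
    by (rule e) (simp add: power2_eq_square algebra_simps)
  have sg: "sg (a + b) * sg (a - b) = 1" "sg (a + b + 1) * sg (a - b) = - 1" for a b
    by (auto simp: sg_def)
  show "(theta3 x)\<^sup>2 = (theta3 (2 * x))\<^sup>2 + (theta2 (2 * x))\<^sup>2"
    unfolding power2_eq_square
    by (rule has_sum_int_rotate [OF prod [OF t3 t3]]; unfold e1 e2; intro prod T3 T2)
  have "((\<lambda>(a, b). - (E (of_int a + 1/2) * E (of_int b + 1/2))) has_sum - (theta2 (2 * x) * theta2 (2 * x))) UNIV"
    using has_sum_uminus [THEN iffD2, of "\<lambda>(a, b). E (of_int a + 1/2) * E (of_int b + 1/2)"] prod [OF T2 T2]
    by (simp add: case_prod_unfold)
  moreover have s: "sg m * u * (sg n * v) = sg m * sg n * (u * v)" for m n u v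
    by (simp add: mult_ac)
  ultimately have "theta4 x * theta4 x = theta3 (2 * x) * theta3 (2 * x) + - (theta2 (2 * x) * theta2 (2 * x))"
    by (intro has_sum_int_rotate [OF prod [OF t4 t4]]; unfold e1 e2 sg s)
       (use prod [OF T3 T3] in \<open>simp_all\<close>)
  then show "(theta4 x)\<^sup>2 = (theta3 (2 * x))\<^sup>2 - (theta2 (2 * x))\<^sup>2"
    by (simp add: power2_eq_square)
  have "theta2 x * theta2 x = theta2 (2 * x) * theta3 (2 * x) + theta3 (2 * x) * theta2 (2 * x)"
    by (rule has_sum_int_rotate [OF prod [OF t2 t2]]; unfold e3 e4; intro prod T3 T2 T3')
  then show "(theta2 x)\<^sup>2 = 2 * theta2 (2 * x) * theta3 (2 * x)"
    by (simp add: power2_eq_square)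
qed

section \<open>Elliptic integrals and the arithmetic-geometric mean\<close>

text \<open>By Gauss this is pi / (2 M(a, b)), with M the arithmetic-geometric mean. In this
  algebraic form a mean step is a rational substitution.\<close>

definition ellJ :: "real \<Rightarrow> real \<Rightarrow> real" where
  "ellJ a b = integral {0<..} (\<lambda>t. 1 / sqrt ((t\<^sup>2 + a\<^sup>2) * (t\<^sup>2 + b\<^sup>2)))"

text \<open>The substitution in \<open>ellJ_agm\<close> maps the half-line onto the whole line;
  evenness brings the integral back at the price of a factor 2.\<close>

lemma absolutely_integrable_even:
  fixes f :: "real \<Rightarrow> real"
  assumes "f absolutely_integrable_on {0<..}" "\<And>x. f (- x) = f x"
  shows "f absolutely_integrable_on UNIV" "integral UNIV f = 2 * integral {0<..} f"
proof -
  have im: "uminus ` {0<..} = {..<(0::real)}"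
    by (auto simp: image_iff intro: bexI [of _ "- _"])
  have "f absolutely_integrable_on uminus ` {0<..} \<and> integral (uminus ` {0<..}) f = integral {0<..} f"
    by (subst has_absolute_integral_change_of_variables_1' [symmetric, where g' = "\<lambda>_. - 1"])
       (use assms in \<open>auto intro!: derivative_eq_intros\<close>)
  then have neg: "f absolutely_integrable_on {..<0}" "integral {..<0} f = integral {0<..} f"
    unfolding im by auto
  have pos: "f absolutely_integrable_on {0..}" "integral {0..} f = integral {0<..} f"
  proof -
    have n: "negligible (sym_diff {0<..} {0::real..})"
      by (rule negligible_subset [of "{0}"]) auto
    show "f absolutely_integrable_on {0..}"
      by (rule absolutely_integrable_spike_set [OF assms(1)]) (rule negligible_subset [OF n], auto)+
    show "integral {0..} f = integral {0<..} f"
      by (rule integral_spike_set) (rule negligible_subset [OF n], auto)+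
  qed
  have U: "{..<0} \<union> {0..} = (UNIV :: real set)" by auto
  show "f absolutely_integrable_on UNIV"
    using absolutely_integrable_Un [OF neg(1) pos(1)] U by simp
  have "(f has_integral (integral {..<0} f + integral {0..} f)) ({..<0} \<union> {0..})"
    using neg(1) pos(1)
    by (intro has_integral_Un integrable_integral) (auto simp: absolutely_integrable_on_def intro: negligible_subset [of "{}"])
  then show "integral UNIV f = 2 * integral {0<..} f"
    unfolding U using neg pos by (simp add: integral_unique)
qed

lemma continuous_on_trig_quotient:
  assumes "a > 0" "b > 0"
  shows "continuous_on S (\<lambda>t. 1 / sqrt (a\<^sup>2 * (sin t)\<^sup>2 + b\<^sup>2 * (cos t)\<^sup>2))"
proof -
  have "a\<^sup>2 * (sin t)\<^sup>2 + b\<^sup>2 * (cos t)\<^sup>2 \<noteq> 0" for t :: real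
    using assms sin_zero_norm_cos_one [of t] by (auto simp: add_nonneg_eq_0_iff)
  then show ?thesis by (intro continuous_intros) auto
qed

text \<open>The substitution is a tan t. It pairs a with the sine and b with the cosine, and it
  reduces integrability to the continuity of the trigonometric integrand on a compact
  interval.\<close>

lemma ellJ_trig_aux:
  assumes ab: "a > 0" "b > 0"
  defines "h \<equiv> \<lambda>t. 1 / sqrt (a\<^sup>2 * (sin t)\<^sup>2 + b\<^sup>2 * (cos t)\<^sup>2)"
  shows ellJ_integrable: "(\<lambda>t. 1 / sqrt ((t\<^sup>2 + a\<^sup>2) * (t\<^sup>2 + b\<^sup>2))) absolutely_integrable_on {0<..}" (is ?A)
    and ellJ_trig: "ellJ a b = integral {0..pi/2} h" (is ?B)
proof -
  let ?S = "{0<..<pi/2}"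
  let ?f = "\<lambda>t. 1 / sqrt ((t\<^sup>2 + a\<^sup>2) * (t\<^sup>2 + b\<^sup>2))"
  define g where "g = (\<lambda>t. a * tan t)"
  define g' where "g' = (\<lambda>t. a / (cos t)\<^sup>2)"
  have cos: "cos t > 0" if "t \<in> ?S" for t using that by (intro cos_gt_zero_pi) auto
  have inj: "inj_on g ?S"
    unfolding g_def using ab
    by (intro strict_mono_on_imp_inj_on strict_mono_onI) (auto intro: tan_monotone)
  have surj: "g ` ?S = {0<..}"
  proof safe
    fix t :: real assume "t \<in> ?S" then show "g t > 0"
      unfolding g_def using ab tan_gt_zero [of t] by simp
  next
    fix u :: real assume "u > 0"
    then have "g (arctan (u / a)) = u" "arctan (u / a) \<in> ?S"
      using ab arctan_ubound unfolding g_def by (auto simp: tan_arctan)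
    then show "u \<in> g ` ?S" by (metis imageI)
  qed
  have key: "\<bar>g' t\<bar> * ?f (g t) = h t" if "t \<in> ?S" for t
  proof -
    have c: "cos t > 0" using cos that by simp
    have 1: "(g t)\<^sup>2 + a\<^sup>2 = a\<^sup>2 / (cos t)\<^sup>2"
      unfolding g_def tan_def using c by (simp add: field_simps sin_squared_eq)
    have 2: "(g t)\<^sup>2 + b\<^sup>2 = (a\<^sup>2 * (sin t)\<^sup>2 + b\<^sup>2 * (cos t)\<^sup>2) / (cos t)\<^sup>2"
      unfolding g_def tan_def using c by (simp add: field_simps)
    show ?thesis
      unfolding 1 2 real_sqrt_mult [of "_ / _"] real_sqrt_divide real_sqrt_abs h_def g'_def using c ab
      by (simp add: power2_eq_square)
  qed
  have hint: "h absolutely_integrable_on {0..pi/2}"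
    unfolding h_def by (intro absolutely_integrable_continuous_real continuous_on_trig_quotient ab)
  then have "h absolutely_integrable_on ?S" "integral ?S h = integral {0..pi/2} h"
    by (auto intro: set_integrable_subset simp: integral_open_interval_real)
  moreover have "(\<lambda>t. \<bar>g' t\<bar> * ?f (g t)) absolutely_integrable_on ?S \<longleftrightarrow> h absolutely_integrable_on ?S"
    by (rule set_integrable_cong) (rule refl key | assumption)+
  moreover have "integral ?S (\<lambda>t. \<bar>g' t\<bar> * ?f (g t)) = integral ?S h"
    by (rule integral_cong) (rule key)
  ultimately have "(\<lambda>t. \<bar>g' t\<bar> * ?f (g t)) absolutely_integrable_on ?S \<and>
      integral ?S (\<lambda>t. \<bar>g' t\<bar> * ?f (g t)) = integral {0..pi/2} h"
    by (intro conjI; simp only:)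
  moreover have "(g has_field_derivative g' t) (at t within ?S)" if "t \<in> ?S" for t
    unfolding g_def g'_def using cos [OF that] by (auto intro!: derivative_eq_intros simp: field_simps)
  ultimately have "?f absolutely_integrable_on g ` ?S \<and> integral (g ` ?S) ?f = integral {0..pi/2} h"
    by (intro has_absolute_integral_change_of_variables_1' [THEN iffD1] inj) auto
  then show ?A ?B unfolding surj ellJ_def by auto
qed

text \<open>For u = (t - a b / t) / 2 one has u^2 + a b = ((t^2 + a b) / (2 t))^2 and u^2 + ((a + b)
  / 2)^2 = (t^2 + a^2) (t^2 + b^2) / (2 t)^2, and du/dt cancels the root of the first factor. The
  factor 2 left over in \<open>key\<close> matches the one from evenness.\<close>

lemma ellJ_agm:
  assumes ab: "a > 0" "b > 0"
  shows "ellJ ((a + b) / 2) (sqrt (a * b)) = ellJ a b"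
proof -
  define f where "f = (\<lambda>t. 1 / sqrt ((t\<^sup>2 + ((a + b) / 2)\<^sup>2) * (t\<^sup>2 + (sqrt (a * b))\<^sup>2)))"
  define h where "h = (\<lambda>t. 1 / sqrt ((t\<^sup>2 + a\<^sup>2) * (t\<^sup>2 + b\<^sup>2)))"
  define g where "g = (\<lambda>t. (t - a * b / t) / 2)"
  define g' where "g' = (\<lambda>t. (1 + a * b / t\<^sup>2) / 2)"
  have f: "f absolutely_integrable_on {0<..}"
    unfolding f_def by (rule ellJ_integrable) (use ab in auto)
  have "integral UNIV f = 2 * integral {0<..} f" "f absolutely_integrable_on UNIV"
    using absolutely_integrable_even [OF f] by (auto simp: f_def)
  have inj: "inj_on g {0<..}"
  proof (rule strict_mono_on_imp_inj_on, rule strict_mono_onI)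
    fix r s :: real assume "r \<in> {0<..}" "s \<in> {0<..}" "r < s"
    then have "a * b / s < a * b / r"
      using ab by (intro divide_strict_left_mono) auto
    then show "g r < g s"
      unfolding g_def using \<open>r < s\<close>
      by (intro divide_strict_right_mono diff_strict_mono) auto
  qed
  have surj: "g ` {0<..} = UNIV"
  proof -
    have "u \<in> g ` {0<..}" for u
    proof -
      \<comment> \<open>The preimage u + w is the positive root of t^2 - 2 u t - a b = 0.\<close>
      define w where "w = sqrt (u\<^sup>2 + a * b)"
      have "w > sqrt (u\<^sup>2)" unfolding w_def using ab by (intro real_sqrt_less_mono) simp
      then have pos: "u + w > 0" by simp
      have "w\<^sup>2 = u\<^sup>2 + a * b" unfolding w_def using ab by simp
      then have "a * b = (w - u) * (u + w)" by (simp add: power2_eq_square algebra_simps)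
      then have "a * b / (u + w) = w - u" using pos by (simp add: field_simps)
      then have "u = g (u + w)"
        unfolding g_def by (simp)
      then show ?thesis using pos by auto
    qed
    then show ?thesis by auto
  qed
  have key: "\<bar>g' t\<bar> * f (g t) = 2 * h t" if "t \<in> {0<..}" for t
  proof -
    have t: "t > 0" using that by simp
    have g1: "(g t)\<^sup>2 + (sqrt (a * b))\<^sup>2 = ((t\<^sup>2 + a * b) / (2 * t))\<^sup>2"
      unfolding g_def using ab t by (simp add: power2_eq_square field_simps)
    have g2: "(g t)\<^sup>2 + ((a + b) / 2)\<^sup>2 = (t\<^sup>2 + a\<^sup>2) * (t\<^sup>2 + b\<^sup>2) / (2 * t)\<^sup>2"
      unfolding g_def using ab t by (simp add: power2_eq_square field_simps)
    have g3: "g' t = (t\<^sup>2 + a * b) / (2 * t\<^sup>2)"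
      unfolding g'_def using t by (simp add: field_simps)
    define p where "p = t\<^sup>2 + a * b"
    have p: "p > 0" unfolding p_def using ab t by (simp add: add_pos_pos)
    have p': "t\<^sup>2 + a\<^sup>2 > 0" "t\<^sup>2 + b\<^sup>2 > 0" using ab t by (auto intro: add_pos_pos)
    define w where "w = sqrt ((t\<^sup>2 + a\<^sup>2) * (t\<^sup>2 + b\<^sup>2))"
    have w: "w > 0" unfolding w_def using p' by simp
    have "f (g t) = 1 / (w / (2 * t) * (p / (2 * t)))"
      unfolding f_def g1 g2 real_sqrt_mult [of "_ / _"] real_sqrt_divide real_sqrt_abs w_def [symmetric]
      using t p unfolding p_def by simp
    then show ?thesis
      unfolding h_def g3 w_def [symmetric] p_def [symmetric] using t p w
      by (simp add: power2_eq_square)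
  qed
  have "(\<lambda>t. \<bar>g' t\<bar> * f (g t)) absolutely_integrable_on {0<..} \<and>
      integral {0<..} (\<lambda>t. \<bar>g' t\<bar> * f (g t)) = 2 * integral {0<..} f"
    by (subst has_absolute_integral_change_of_variables_1')
       (use inj surj \<open>integral UNIV f = _\<close> \<open>f absolutely_integrable_on UNIV\<close> in
        \<open>auto simp: g_def g'_def power2_eq_square field_simps intro!: derivative_eq_intros\<close>)
  moreover have "integral {0<..} (\<lambda>t. \<bar>g' t\<bar> * f (g t)) = 2 * integral {0<..} h"
    using key by (subst integral_cong [of _ _ "\<lambda>t. 2 * h t"]) auto
  ultimately show ?thesis
    unfolding ellJ_def f_def h_def by simp
qed

lemma ellJ_scale:
  assumes c: "c > 0" and "a > 0" "b > 0"
  shows "ellJ (c * a) (c * b) = ellJ a b / c"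
proof -
  have "sqrt ((c * a)\<^sup>2 * u + (c * b)\<^sup>2 * v) = c * sqrt (a\<^sup>2 * u + b\<^sup>2 * v)" for u v
  proof -
    have "(c * a)\<^sup>2 * u + (c * b)\<^sup>2 * v = c\<^sup>2 * (a\<^sup>2 * u + b\<^sup>2 * v)"
      by (simp add: algebra_simps)
    then show ?thesis using c by (simp add: real_sqrt_mult)
  qed
  then show ?thesis
    using assms by (simp add: ellJ_trig integral_divide [of _ "\<lambda>t. 1 / sqrt (_ t)", symmetric] mult.commute)
qed

lemma ellJ_commute: "ellJ a b = ellJ b a"
  by (simp add: ellJ_def mult.commute)

lemma ellJ_antimono:
  assumes "0 < a" "a \<le> a'" "0 < b" "b \<le> b'"
  shows "ellJ a' b' \<le> ellJ a b"
  unfolding ellJ_def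
proof (rule integral_le)
  show "(\<lambda>t. 1 / sqrt ((t\<^sup>2 + a'\<^sup>2) * (t\<^sup>2 + b'\<^sup>2))) integrable_on {0<..}"
       "(\<lambda>t. 1 / sqrt ((t\<^sup>2 + a\<^sup>2) * (t\<^sup>2 + b\<^sup>2))) integrable_on {0<..}"
    using ellJ_integrable [of a b] ellJ_integrable [of a' b'] assms
    by (auto simp: absolutely_integrable_on_def)
  fix t :: real assume "t \<in> {0<..}"
  moreover have "a\<^sup>2 \<le> a'\<^sup>2" "b\<^sup>2 \<le> b'\<^sup>2" using assms by auto
  ultimately show "1 / sqrt ((t\<^sup>2 + a'\<^sup>2) * (t\<^sup>2 + b'\<^sup>2)) \<le> 1 / sqrt ((t\<^sup>2 + a\<^sup>2) * (t\<^sup>2 + b\<^sup>2))"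
    by (intro divide_left_mono real_sqrt_le_mono mult_mono mult_pos_pos real_sqrt_gt_zero)
       (auto intro: add_pos_nonneg)
qed

section \<open>K and E in trigonometric form, with elementary bounds\<close>

lemma compl_modulus:
  assumes "0 < k" "k < 1"
  shows compl_modulus_pos: "compl_modulus k > 0" and compl_modulus_less_1: "compl_modulus k < 1"
    and compl_modulus_square: "(compl_modulus k)\<^sup>2 = 1 - k\<^sup>2"
    and compl_modulus_compl: "compl_modulus (compl_modulus k) = k"
proof -
  have *: "k\<^sup>2 < 1" using assms by (simp add: power_less_one_iff)
  moreover have "k\<^sup>2 > 0" using assms by simp
  ultimately show "compl_modulus k > 0" "compl_modulus k < 1" "(compl_modulus k)\<^sup>2 = 1 - k\<^sup>2"
    unfolding compl_modulus_def by simp_all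
  then show "compl_modulus (compl_modulus k) = k"
    unfolding compl_modulus_def [of "compl_modulus k"] using assms by simp
qed

text \<open>Legendre's Delta. The substitution of the sine makes K and E the integrals of 1 / Delta
  and Delta, without the endpoint singularity, so that differentiation under the integral sign
  becomes available.\<close>

definition ellDelta :: "real \<Rightarrow> real \<Rightarrow> real" where
  "ellDelta k t = sqrt (1 - k\<^sup>2 * (sin t)\<^sup>2)"

lemma ellDelta_props:
  assumes "0 < k" "k < 1"
  shows ellDelta_pos: "ellDelta k t > 0"
    and ellDelta_square: "(ellDelta k t)\<^sup>2 = 1 - k\<^sup>2 * (sin t)\<^sup>2"
    and ellDelta_ge: "compl_modulus k \<le> ellDelta k t"
    and ellDelta_le_1: "ellDelta k t \<le> 1"
proof -
  have *: "k\<^sup>2 < 1" using assms by (simp add: power_less_one_iff)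
  have "(sin t)\<^sup>2 \<le> 1" using sin_cos_squared_add [of t] by (simp add: sin_squared_eq)
  then have "k\<^sup>2 * (sin t)\<^sup>2 \<le> k\<^sup>2 * 1" by (intro mult_left_mono) auto
  then have le: "1 - k\<^sup>2 \<le> 1 - k\<^sup>2 * (sin t)\<^sup>2" by simp
  with * have "1 - k\<^sup>2 * (sin t)\<^sup>2 > 0" by linarith
  then show "ellDelta k t > 0" "(ellDelta k t)\<^sup>2 = 1 - k\<^sup>2 * (sin t)\<^sup>2"
    unfolding ellDelta_def by simp_all
  show "compl_modulus k \<le> ellDelta k t"
    unfolding compl_modulus_def ellDelta_def using le by (rule real_sqrt_le_mono)
  show "ellDelta k t \<le> 1"
    unfolding ellDelta_def by simp
qed

lemma continuous_on_ellDelta [continuous_intros]: "continuous_on S (ellDelta k)"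
  unfolding ellDelta_def [abs_def] by (intro continuous_intros)

text \<open>The integrands defining K and E blow up at 1, so the equation is required on the open
  interval only; integrability comes from the continuity of \<open>h\<close>.\<close>

lemma integral_sin_substitution:
  fixes f :: "real \<Rightarrow> real"
  assumes cont: "continuous_on {0..pi/2} h"
    and eq: "\<And>t. 0 < t \<Longrightarrow> t < pi/2 \<Longrightarrow> cos t * f (sin t) = h t"
  shows "integral {0..1} f = integral {0..pi/2} h"
proof -
  let ?S = "{0<..<pi/2}"
  have cos: "cos t > 0" if "t \<in> ?S" for t using that by (intro cos_gt_zero_pi) auto
  have inj: "inj_on sin ?S"
    by (intro strict_mono_on_imp_inj_on strict_mono_onI) (auto intro: sin_monotone_2pi)
  have surj: "sin ` ?S = {0<..<1}"
  proof safe
    fix t :: real assume t: "t \<in> ?S"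
    have "sin t < sin (pi/2)" using t by (intro sin_monotone_2pi) auto
    then show "sin t \<in> {0<..<1}" using t by (auto intro!: sin_gt_zero)
  next
    fix u :: real assume "u \<in> {0<..<1}"
    then have u: "u > 0" "u < 1" by auto
    have "arcsin 0 < arcsin u" "arcsin u < arcsin 1" using u by (intro arcsin_less_arcsin; simp)+
    then have "sin (arcsin u) = u" "arcsin u \<in> ?S" using u by auto
    then show "u \<in> sin ` ?S" by (metis imageI)
  qed
  have h: "h absolutely_integrable_on {0..pi/2}"
    by (intro absolutely_integrable_continuous_real cont)
  then have "h absolutely_integrable_on ?S" "integral ?S h = integral {0..pi/2} h"
    by (auto intro: set_integrable_subset simp: integral_open_interval_real)
  moreover have key: "\<bar>cos t\<bar> * f (sin t) = h t" if "t \<in> ?S" for t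
    using cos [OF that] eq [of t] that by simp
  moreover have "(\<lambda>t. \<bar>cos t\<bar> * f (sin t)) absolutely_integrable_on ?S \<longleftrightarrow> h absolutely_integrable_on ?S"
    by (rule set_integrable_cong) (rule refl key | assumption)+
  moreover have "integral ?S (\<lambda>t. \<bar>cos t\<bar> * f (sin t)) = integral ?S h"
    by (rule integral_cong) (rule key)
  moreover have "(sin has_field_derivative cos t) (at t within ?S)" for t :: real
    by (auto intro!: derivative_eq_intros)
  ultimately have "f absolutely_integrable_on sin ` ?S \<and> integral (sin ` ?S) f = integral {0..pi/2} h"
    by (intro has_absolute_integral_change_of_variables_1' [THEN iffD1] inj) auto
  then show ?thesis
    unfolding surj by (simp add: integral_open_interval_real)
qed

lemma elliptic_has_integral:
  assumes k: "0 < k" "k < 1"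
  shows ellK_has_integral: "((\<lambda>t. 1 / ellDelta k t) has_integral ellK k) {0..pi/2}"
    and ellE_has_integral: "(ellDelta k has_integral ellE k) {0..pi/2}"
proof -
  have nz: "ellDelta k t \<noteq> 0" for t using ellDelta_pos [OF k, of t] by simp
  have cK: "continuous_on {0..pi/2} (\<lambda>t. 1 / ellDelta k t)"
    by (intro continuous_intros) (simp add: nz)
  have cE: "continuous_on {0..pi/2} (ellDelta k)" by (intro continuous_intros)
  have c: "cos t > 0" "1 - (sin t)\<^sup>2 = (cos t)\<^sup>2" if "0 < t" "t < pi/2" for t :: real
    using that by (auto intro!: cos_gt_zero_pi simp: sin_squared_eq)
  have "ellK k = integral {0..pi/2} (\<lambda>t. 1 / ellDelta k t)"
    unfolding ellK_def
  proof (rule integral_sin_substitution [OF cK])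
    show "cos t * (1 / sqrt ((1 - (sin t)\<^sup>2) * (1 - k\<^sup>2 * (sin t)\<^sup>2))) = 1 / ellDelta k t"
      if "0 < t" "t < pi/2" for t
      unfolding c(2) [OF that] ellDelta_def real_sqrt_mult using c(1) [OF that] by simp
  qed
  then show "((\<lambda>t. 1 / ellDelta k t) has_integral ellK k) {0..pi/2}"
    using integrable_continuous_real [OF cK] by (simp add: has_integral_integral)
  have "ellE k = integral {0..pi/2} (ellDelta k)"
    unfolding ellE_def
  proof (rule integral_sin_substitution [OF cE])
    show "cos t * sqrt ((1 - k\<^sup>2 * (sin t)\<^sup>2) / (1 - (sin t)\<^sup>2)) = ellDelta k t"
      if "0 < t" "t < pi/2" for t
      unfolding c(2) [OF that] ellDelta_def real_sqrt_divide using c(1) [OF that] by simp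
  qed
  then show "(ellDelta k has_integral ellE k) {0..pi/2}"
    using integrable_continuous_real [OF cE] by (simp add: has_integral_integral)
qed

text \<open>k'^2 sin^2 + cos^2 = 1 - k^2 sin^2, so the trigonometric form for the parameters k' and
  1 has exactly the integrand of K; symmetry then swaps the parameters.\<close>

lemma ellK_eq_ellJ:
  assumes k: "0 < k" "k < 1"
  shows "ellK k = ellJ 1 (compl_modulus k)"
proof -
  have eq: "1 / sqrt ((compl_modulus k)\<^sup>2 * (sin t)\<^sup>2 + 1\<^sup>2 * (cos t)\<^sup>2) = 1 / ellDelta k t" for t
    unfolding ellDelta_def compl_modulus_square [OF k] cos_squared_eq by (simp add: algebra_simps)
  have "ellJ (compl_modulus k) 1 = integral {0..pi/2} (\<lambda>t. 1 / ellDelta k t)"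
    unfolding ellJ_trig [OF compl_modulus_pos [OF k] zero_less_one] eq ..
  then show ?thesis
    using ellK_has_integral [OF k] ellJ_commute by (metis integral_unique)
qed

lemma ellJ_same:
  assumes "c > 0"
  shows "ellJ c c = pi / (2 * c)"
proof -
  have "c\<^sup>2 * (sin t)\<^sup>2 + c\<^sup>2 * (cos t)\<^sup>2 = c\<^sup>2" for t :: real
    by (simp add: distrib_left [symmetric])
  then show ?thesis using assms by (simp add: ellJ_trig)
qed

lemma ellK_bounds:
  assumes k: "0 < k" "k < 1"
  shows "pi / 2 \<le> ellK k" "ellK k \<le> pi / 2 / compl_modulus k"
proof -
  note D = ellDelta_props [OF k]
  have "((\<lambda>t. 1) has_integral (pi/2)) {0..pi/2}"
    using has_integral_const_real [of "1 :: real" 0 "pi/2"] by simp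
  then show "pi / 2 \<le> ellK k"
    by (rule has_integral_le [OF _ ellK_has_integral [OF k]]) (simp add: D)
  have "((\<lambda>t. 1 / compl_modulus k) has_integral (pi / 2 / compl_modulus k)) {0..pi/2}"
    using has_integral_const_real [of "1 / compl_modulus k" 0 "pi/2"] by simp
  then show "ellK k \<le> pi / 2 / compl_modulus k"
    by (rule has_integral_le [OF ellK_has_integral [OF k]])
       (simp add: D compl_modulus_pos [OF k] frac_le)
qed

text \<open>Delta^2 = cos^2 + k'^2 sin^2 places Delta between cos t and cos t + k'. The bounds are
  tight when the modulus approaches 1, which is the regime of E(k') in the limit of Legendre's
  relation.\<close>

lemma ellE_bounds:
  assumes k: "0 < k" "k < 1"
  shows "1 \<le> ellE k" "ellE k \<le> 1 + pi / 2 * compl_modulus k"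
proof -
  note D = ellDelta_props [OF k]
  have cosint: "(cos has_integral 1) {0..pi/2}"
  proof -
    have "(sin has_vector_derivative cos t) (at t within {0..pi/2})" for t
      unfolding has_real_derivative_iff_has_vector_derivative [symmetric]
      by (rule DERIV_subset [OF DERIV_sin]) simp
    then show ?thesis
      using fundamental_theorem_of_calculus [of 0 "pi/2" sin cos] by simp
  qed
  have cos: "cos t \<ge> 0" if "t \<in> {0..pi/2}" for t :: real
    using that by (auto intro: cos_ge_zero)
  have sq: "(ellDelta k t)\<^sup>2 = (cos t)\<^sup>2 + (compl_modulus k)\<^sup>2 * (sin t)\<^sup>2" for t
    unfolding D compl_modulus_square [OF k] cos_squared_eq by (simp add: algebra_simps)
  show "1 \<le> ellE k"
    by (rule has_integral_le [OF cosint ellE_has_integral [OF k]])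
       (rule power2_le_imp_le, use sq D(1) less_imp_le in auto)
  have "((\<lambda>t. cos t + compl_modulus k) has_integral (1 + pi / 2 * compl_modulus k)) {0..pi/2}"
    using has_integral_add [OF cosint has_integral_const_real [of "compl_modulus k" 0 "pi/2"]] by simp
  then show "ellE k \<le> 1 + pi / 2 * compl_modulus k"
  proof (rule has_integral_le [OF ellE_has_integral [OF k]])
    fix t :: real assume t: "t \<in> {0..pi/2}"
    have "(compl_modulus k)\<^sup>2 * (sin t)\<^sup>2 \<le> (compl_modulus k)\<^sup>2 * 1"
      by (intro mult_left_mono) (auto simp: sin_squared_eq)
    moreover have "0 \<le> cos t * compl_modulus k"
      using cos [OF t] compl_modulus_pos [OF k] by simp
    ultimately have "(ellDelta k t)\<^sup>2 \<le> (cos t + compl_modulus k)\<^sup>2"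
      unfolding sq power2_sum by simp
    then show "ellDelta k t \<le> cos t + compl_modulus k"
      using cos [OF t] compl_modulus_pos [OF k] by (intro power2_le_imp_le [of "ellDelta k t"]) auto
  qed
qed

text \<open>The integrand is 1 / Delta - Delta = k^2 sin^2 / Delta. Its factor k^2 outweighs the
  growth of K(k') as k tends to 0.\<close>

lemma ellK_minus_ellE_bounds:
  assumes k: "0 < k" "k < 1"
  shows "0 \<le> ellK k - ellE k" "ellK k - ellE k \<le> k\<^sup>2 * ellK k"
proof -
  note D = ellDelta_props [OF k]
  have int: "((\<lambda>t. 1 / ellDelta k t - ellDelta k t) has_integral (ellK k - ellE k)) {0..pi/2}"
    by (intro has_integral_diff ellK_has_integral ellE_has_integral k)
  have eq: "1 / ellDelta k t - ellDelta k t = k\<^sup>2 * (sin t)\<^sup>2 * (1 / ellDelta k t)" for t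
  proof -
    have "1 / ellDelta k t - ellDelta k t = (1 - (ellDelta k t)\<^sup>2) * (1 / ellDelta k t)"
      using D(1) [of t] by (simp add: field_simps power2_eq_square)
    then show ?thesis unfolding D by simp
  qed
  show "0 \<le> ellK k - ellE k"
    by (rule has_integral_nonneg [OF int]) (simp add: eq D(1) less_imp_le)
  show "ellK k - ellE k \<le> k\<^sup>2 * ellK k"
  proof (rule has_integral_le [OF int has_integral_mult_right [OF ellK_has_integral [OF k]]])
    fix t :: real
    have "k\<^sup>2 * (sin t)\<^sup>2 \<le> k\<^sup>2 * 1"
      by (intro mult_left_mono) (auto simp: sin_squared_eq)
    then show "1 / ellDelta k t - ellDelta k t \<le> k\<^sup>2 * (1 / ellDelta k t)"
      unfolding eq using D(1) [of t] by (intro mult_right_mono) auto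
  qed
qed

text \<open>For small b the integral concentrates near t = 0, where cos t / sqrt (sin^2 t + b^2)
  approximates the integrand and has the antiderivative arsinh (sin t / b). This isolates the
  logarithmic growth as b tends to 0.\<close>

lemma ellJ_log_bounds:
  assumes b: "0 < b" "b < 1"
  shows "arsinh (1 / b) \<le> ellJ 1 b" "ellJ 1 b \<le> arsinh (1 / b) / sqrt (1 - b\<^sup>2) + pi / 2"
proof -
  let ?h = "\<lambda>t. 1 / sqrt (1\<^sup>2 * (sin t)\<^sup>2 + b\<^sup>2 * (cos t)\<^sup>2)"
  let ?f = "\<lambda>t. cos t / sqrt ((sin t)\<^sup>2 + b\<^sup>2)"
  have int: "(?h has_integral ellJ 1 b) {0..pi/2}"
    using integrable_continuous_real [OF continuous_on_trig_quotient [OF zero_less_one b(1)]]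
    unfolding ellJ_trig [OF zero_less_one b(1)] by (rule integrable_integral)
  have "((\<lambda>t. arsinh (sin t / b)) has_vector_derivative ?f t) (at t within {0..pi/2})" for t
  proof -
    have "(sin t / b)\<^sup>2 + 1 = ((sin t)\<^sup>2 + b\<^sup>2) / b\<^sup>2"
      using b by (simp add: field_simps)
    then have eq: "sqrt ((sin t / b)\<^sup>2 + 1) = sqrt ((sin t)\<^sup>2 + b\<^sup>2) / b"
      using b by (simp only: real_sqrt_divide real_sqrt_abs)
    have "((\<lambda>t. arsinh (sin t / b)) has_field_derivative 1 / sqrt ((sin t / b)\<^sup>2 + 1) * (cos t / b)) (at t within {0..pi/2})"
      using b by (intro DERIV_chain2 [OF arsinh_real_has_field_derivative])
        (auto intro!: derivative_eq_intros)
    then show ?thesis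
      unfolding has_real_derivative_iff_has_vector_derivative [symmetric] eq using b by simp
  qed
  then have f: "(?f has_integral arsinh (1 / b)) {0..pi/2}"
    using fundamental_theorem_of_calculus [of 0 "pi/2" "\<lambda>t. arsinh (sin t / b)" ?f] by simp
  have pos: "(sin t)\<^sup>2 + b\<^sup>2 > 0" for t using b by (simp add: add_nonneg_pos)
  have pos': "1\<^sup>2 * (sin t)\<^sup>2 + b\<^sup>2 * (cos t)\<^sup>2 > 0" for t
  proof -
    have "b\<^sup>2 * (sin t)\<^sup>2 \<le> 1\<^sup>2 * (sin t)\<^sup>2"
      using b by (intro mult_right_mono power_mono) auto
    then have "b\<^sup>2 \<le> 1\<^sup>2 * (sin t)\<^sup>2 + b\<^sup>2 * (cos t)\<^sup>2"
      unfolding cos_squared_eq by (simp add: algebra_simps)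
    moreover have "0 < b\<^sup>2" using b by simp
    ultimately show ?thesis by linarith
  qed
  show "arsinh (1 / b) \<le> ellJ 1 b"
  proof (rule has_integral_le [OF f int])
    fix t :: real assume t: "t \<in> {0..pi/2}"
    have "b\<^sup>2 * (cos t)\<^sup>2 \<le> b\<^sup>2 * 1"
      by (intro mult_left_mono) (auto simp: cos_squared_eq)
    then have "sqrt (1\<^sup>2 * (sin t)\<^sup>2 + b\<^sup>2 * (cos t)\<^sup>2) \<le> sqrt ((sin t)\<^sup>2 + b\<^sup>2)"
      by (intro real_sqrt_le_mono) simp
    then show "?f t \<le> ?h t"
      using t pos' [of t] by (intro frac_le) auto
  qed
  have b2: "1 - b\<^sup>2 > 0" using b by (simp add: power_less_one_iff)
  show "ellJ 1 b \<le> arsinh (1 / b) / sqrt (1 - b\<^sup>2) + pi / 2"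
  proof (rule has_integral_le [OF int])
    show "((\<lambda>t. ?f t / sqrt (1 - b\<^sup>2) + 1) has_integral (arsinh (1 / b) / sqrt (1 - b\<^sup>2) + pi / 2)) {0..pi/2}"
      using has_integral_add [OF has_integral_divide [OF f] has_integral_const_real [of 1 0 "pi/2"]] by simp
    fix t :: real assume t: "t \<in> {0..pi/2}"
    \<comment> \<open>1 / w splits into cos t / w and (1 - cos t) / w. The second part is at most 1
      because 1 - cos t <= sin t <= w, and integrates to at most pi / 2; the first is compared with
      \<open>?f\<close>.\<close>
    define w where "w = sqrt (1\<^sup>2 * (sin t)\<^sup>2 + b\<^sup>2 * (cos t)\<^sup>2)"
    have w: "w > 0" unfolding w_def using pos' by (rule real_sqrt_gt_zero)
    have st: "sin t \<ge> 0" "cos t \<ge> 0" using t by (auto intro: sin_ge_zero cos_ge_zero)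
    have "sin t = sqrt ((sin t)\<^sup>2)" using st by simp
    also have "\<dots> \<le> w" unfolding w_def by (rule real_sqrt_le_mono) simp
    finally have sw: "sin t \<le> w" .
    have "((sin t)\<^sup>2 + b\<^sup>2) * (1 - b\<^sup>2) \<le> 1\<^sup>2 * (sin t)\<^sup>2 + b\<^sup>2 * (cos t)\<^sup>2"
      unfolding cos_squared_eq by (simp add: algebra_simps)
    then have le: "sqrt ((sin t)\<^sup>2 + b\<^sup>2) * sqrt (1 - b\<^sup>2) \<le> w"
      unfolding w_def real_sqrt_mult [symmetric] by (rule real_sqrt_le_mono)
    have "1 \<le> (sin t + cos t)\<^sup>2"
      unfolding power2_sum using st by simp
    then have "1 - cos t \<le> sin t"
      using st power2_le_imp_le [of 1 "sin t + cos t"] by simp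
    then have "(1 - cos t) / w \<le> 1"
      using sw w by simp
    moreover have "cos t / w \<le> ?f t / sqrt (1 - b\<^sup>2)"
      unfolding divide_divide_eq_left using st le pos [of t] b2 w by (intro divide_left_mono) auto
    ultimately show "?h t \<le> ?f t / sqrt (1 - b\<^sup>2) + 1"
      unfolding w_def [symmetric] by (simp add: diff_divide_distrib)
  qed
qed

section \<open>Derivatives and the Legendre relation\<close>

lemma ellE_has_field_derivative:
  assumes k: "0 < k" "k < 1"
  shows "(ellE has_field_derivative (ellE k - ellK k) / k) (at k)"
proof -
  let ?U = "{0<..<1::real}"
  define f' where "f' k t = - (k * (sin t)\<^sup>2) / ellDelta k t" for k t
  have nz: "ellDelta k t \<noteq> 0" if "k \<in> ?U" for k t using ellDelta_pos [of k t] that by simp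
  have "((\<lambda>k. integral (cbox 0 (pi/2)) (ellDelta k)) has_field_derivative
      integral (cbox 0 (pi/2)) (f' k)) (at k within ?U)"
  proof (rule leibniz_rule_field_derivative)
    fix k t :: real assume k: "k \<in> ?U"
    then have "1 - k\<^sup>2 * (sin t)\<^sup>2 > 0"
      using ellDelta_square [of k t] ellDelta_pos [of k t] by (metis greaterThanLessThan_iff zero_less_power)
    then show "((\<lambda>k. ellDelta k t) has_field_derivative f' k t) (at k within ?U)"
      unfolding ellDelta_def f'_def by (auto intro!: derivative_eq_intros simp: field_simps)
  next
    show "ellDelta k integrable_on cbox 0 (pi/2)" for k
      by (intro integrable_continuous continuous_intros)
    have "continuous_on (?U \<times> cbox 0 (pi/2)) (\<lambda>p. f' (fst p) (snd p))"
      unfolding f'_def ellDelta_def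
      by (intro continuous_intros) (use nz in \<open>auto simp: ellDelta_def\<close>)
    then show "continuous_on (?U \<times> cbox 0 (pi/2)) (\<lambda>(k, t). f' k t)"
      by (simp add: case_prod_unfold)
  qed (use k in auto)
  moreover have "integral (cbox 0 (pi/2)) (f' k) = (ellE k - ellK k) / k"
  proof (rule integral_unique)
    \<comment> \<open>Replacing k^2 sin^2 by 1 - Delta^2 expresses the differentiated integrand
      through those of E and K.\<close>
    have "f' k t = (ellDelta k t - 1 / ellDelta k t) / k" for t
    proof -
      have "k\<^sup>2 * (sin t)\<^sup>2 = 1 - (ellDelta k t)\<^sup>2"
        using ellDelta_square [OF k, of t] by simp
      then have "k * (sin t)\<^sup>2 = (1 - (ellDelta k t)\<^sup>2) / k"
        using k by (simp add: field_simps power2_eq_square)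
      then show ?thesis
        unfolding f'_def using nz [of k t] k by (simp add: field_simps power2_eq_square)
    qed
    then have "f' k = (\<lambda>t. (ellDelta k t - 1 / ellDelta k t) / k)" by auto
    then show "(f' k has_integral (ellE k - ellK k) / k) (cbox 0 (pi/2))"
      using has_integral_divide [OF has_integral_diff [OF ellE_has_integral [OF k] ellK_has_integral [OF k]]]
      by simp
  qed
  ultimately have "((\<lambda>k. integral (cbox 0 (pi/2)) (ellDelta k)) has_field_derivative
      (ellE k - ellK k) / k) (at k)"
    using k by (simp add: at_within_open [of k ?U])
  then show ?thesis
    by (rule has_field_derivative_transform_within_open [where S = ?U])
       (use k ellE_has_integral in \<open>auto simp: integral_unique\<close>)
qed

lemma ellK_has_field_derivative:
  assumes k: "0 < k" "k < 1"
  shows "(ellK has_field_derivative (ellE k - (1 - k\<^sup>2) * ellK k) / (k * (1 - k\<^sup>2))) (at k)"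
proof -
  let ?U = "{0<..<1::real}"
  define f' where "f' k t = k * (sin t)\<^sup>2 / ellDelta k t ^ 3" for k t
  have nz: "ellDelta k t \<noteq> 0" if "k \<in> ?U" for k t using ellDelta_pos [of k t] that by simp
  have "((\<lambda>k. integral (cbox 0 (pi/2)) (\<lambda>t. 1 / ellDelta k t)) has_field_derivative
      integral (cbox 0 (pi/2)) (f' k)) (at k within ?U)"
  proof (rule leibniz_rule_field_derivative)
    fix k t :: real assume k: "k \<in> ?U"
    then have "1 - k\<^sup>2 * (sin t)\<^sup>2 > 0"
      using ellDelta_square [of k t] ellDelta_pos [of k t] by (metis greaterThanLessThan_iff zero_less_power)
    then have *: "((\<lambda>k. ellDelta k t) has_field_derivative - (k * (sin t)\<^sup>2) / ellDelta k t) (at k within ?U)"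
      unfolding ellDelta_def by (auto intro!: derivative_eq_intros simp: field_simps)
    show "((\<lambda>k. 1 / ellDelta k t) has_field_derivative f' k t) (at k within ?U)"
      by (rule derivative_eq_intros * refl nz k)+
         (use nz [OF k, of t] in \<open>simp add: f'_def field_simps power2_eq_square power3_eq_cube\<close>)
  next
    show "(\<lambda>t. 1 / ellDelta k t) integrable_on cbox 0 (pi/2)" if "k \<in> ?U" for k
      by (intro integrable_continuous continuous_intros) (use nz [OF that] in auto)
    have "continuous_on (?U \<times> cbox 0 (pi/2)) (\<lambda>p. f' (fst p) (snd p))"
      unfolding f'_def ellDelta_def
      by (intro continuous_intros) (use nz in \<open>auto simp: ellDelta_def\<close>)
    then show "continuous_on (?U \<times> cbox 0 (pi/2)) (\<lambda>(k, t). f' k t)"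
      by (simp add: case_prod_unfold)
  qed (use k in auto)
  moreover have "integral (cbox 0 (pi/2)) (f' k) = (ellE k - (1 - k\<^sup>2) * ellK k) / (k * (1 - k\<^sup>2))"
  proof (rule integral_unique)
    \<comment> \<open>The differentiated integrand involves 1 / Delta^3. The function g vanishes at
      both ends of the interval and has derivative Delta - (1 - k^2) / Delta^3, so (1 - k^2) /
      Delta^3 has integral E.\<close>
    define g where "g t = k\<^sup>2 * sin t * cos t / ellDelta k t" for t
    define g' where "g' t = ellDelta k t - (1 - k\<^sup>2) / ellDelta k t ^ 3" for t
    have k2: "1 - k\<^sup>2 > 0" using k by (simp add: power_less_one_iff)
    have "(g has_field_derivative g' t) (at t within {0..pi/2})" for t
    proof -
      have p: "1 - k\<^sup>2 * (sin t)\<^sup>2 > 0"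
        using ellDelta_square [OF k, of t] ellDelta_pos [OF k, of t] by (metis zero_less_power)
      have D: "((\<lambda>t. ellDelta k t) has_field_derivative - (k\<^sup>2 * sin t * cos t) / ellDelta k t) (at t within {0..pi/2})"
        unfolding ellDelta_def using p by (auto intro!: derivative_eq_intros simp: field_simps)
      define d where "d = ellDelta k t"
      have d: "d \<noteq> 0" "d\<^sup>2 = 1 - k\<^sup>2 * (sin t)\<^sup>2"
        unfolding d_def using nz k ellDelta_square [OF k] by auto
      have "(g has_field_derivative (k\<^sup>2 * (cos t * cos t - sin t * sin t) * d
          - k\<^sup>2 * sin t * cos t * (- (k\<^sup>2 * sin t * cos t) / d)) / (d * d)) (at t within {0..pi/2})"
        unfolding g_def [abs_def] d_def
        by (rule derivative_eq_intros D refl)+ (use nz [of k t] k in \<open>simp_all add: algebra_simps\<close>)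
      moreover have "(k\<^sup>2 * (cos t * cos t - sin t * sin t) * d
          - k\<^sup>2 * sin t * cos t * (- (k\<^sup>2 * sin t * cos t) / d)) / (d * d) = d - (1 - k\<^sup>2) / d ^ 3"
      proof -
        have "k\<^sup>2 * (cos t * cos t - sin t * sin t) * d\<^sup>2 + k ^ 4 * (sin t)\<^sup>2 * (cos t)\<^sup>2 = (d\<^sup>2)\<^sup>2 - (1 - k\<^sup>2)"
          unfolding d(2) power2_eq_square [of "cos t", symmetric] power2_eq_square [of "sin t", symmetric] cos_squared_eq
          by algebra
        then show ?thesis
          using d(1) by (simp add: field_simps power2_eq_square power3_eq_cube power4_eq_xxxx)
      qed
      ultimately show ?thesis unfolding g'_def d_def by simp
    qed
    then have int: "(g' has_integral 0) {0..pi/2}"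
      using fundamental_theorem_of_calculus [of 0 "pi/2" g g']
      by (simp add: has_real_derivative_iff_has_vector_derivative g_def)
    have "f' k t = ((ellDelta k t - g' t) / (1 - k\<^sup>2) - 1 / ellDelta k t) / k" for t
    proof -
      have "k\<^sup>2 * (sin t)\<^sup>2 = 1 - (ellDelta k t)\<^sup>2"
        using ellDelta_square [OF k, of t] by simp
      then have e1: "k * (sin t)\<^sup>2 = (1 - (ellDelta k t)\<^sup>2) / k"
        using k by (simp add: field_simps power2_eq_square)
      have e2: "(ellDelta k t - g' t) / (1 - k\<^sup>2) = 1 / ellDelta k t ^ 3"
        unfolding g'_def using k2 by simp
      show ?thesis
        unfolding f'_def e1 e2 using nz [of k t] k
        by (simp add: field_simps power2_eq_square power3_eq_cube)
    qed
    then have "f' k = (\<lambda>t. ((ellDelta k t - g' t) / (1 - k\<^sup>2) - 1 / ellDelta k t) / k)" by auto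
    moreover have "((\<lambda>t. ((ellDelta k t - g' t) / (1 - k\<^sup>2) - 1 / ellDelta k t) / k) has_integral
        ((ellE k - 0) / (1 - k\<^sup>2) - ellK k) / k) {0..pi/2}"
      by (intro has_integral_divide has_integral_diff ellE_has_integral ellK_has_integral k int)
    moreover have "((ellE k - 0) / (1 - k\<^sup>2) - ellK k) / k = (ellE k - (1 - k\<^sup>2) * ellK k) / (k * (1 - k\<^sup>2))"
      using k k2 by (simp add: divide_simps)
    ultimately show "(f' k has_integral (ellE k - (1 - k\<^sup>2) * ellK k) / (k * (1 - k\<^sup>2))) (cbox 0 (pi/2))"
      by simp
  qed
  ultimately have "((\<lambda>k. integral (cbox 0 (pi/2)) (\<lambda>t. 1 / ellDelta k t)) has_field_derivative
      (ellE k - (1 - k\<^sup>2) * ellK k) / (k * (1 - k\<^sup>2))) (at k)"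
    using k by (simp add: at_within_open [of k ?U])
  then show ?thesis
    by (rule has_field_derivative_transform_within_open [where S = ?U])
       (use k ellK_has_integral in \<open>auto simp: integral_unique\<close>)
qed

lemma compl_modulus_has_field_derivative:
  assumes k: "0 < k" "k < 1"
  shows "(compl_modulus has_field_derivative - k / compl_modulus k) (at k)"
proof -
  have "1 - k\<^sup>2 > 0" using k by (simp add: power_less_one_iff)
  then show ?thesis
    unfolding compl_modulus_def [abs_def] by (auto intro!: derivative_eq_intros simp: field_simps)
qed

lemma compl_derivatives:
  assumes k: "0 < k" "k < 1"
  shows ellK_compl_has_field_derivative:
      "((\<lambda>k. ellK (compl_modulus k)) has_field_derivative
        - (ellE (compl_modulus k) - k\<^sup>2 * ellK (compl_modulus k)) / (k * (1 - k\<^sup>2))) (at k)"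
    and ellE_compl_has_field_derivative:
      "((\<lambda>k. ellE (compl_modulus k)) has_field_derivative
        - k * (ellE (compl_modulus k) - ellK (compl_modulus k)) / (1 - k\<^sup>2)) (at k)"
proof -
  define c where "c = compl_modulus k"
  have c: "0 < c" "c < 1" "c\<^sup>2 = 1 - k\<^sup>2"
    unfolding c_def using compl_modulus [OF k] by auto
  have c2: "1 - c\<^sup>2 = k\<^sup>2" using c(3) by simp
  have D: "(compl_modulus has_field_derivative - k / c) (at k)"
    unfolding c_def by (rule compl_modulus_has_field_derivative [OF k])
  have "((\<lambda>k. ellK (compl_modulus k)) has_field_derivative
      (ellE c - (1 - c\<^sup>2) * ellK c) / (c * (1 - c\<^sup>2)) * (- k / c)) (at k)"
    by (rule DERIV_chain2 [OF _ D]) (use ellK_has_field_derivative [OF c(1,2)] in \<open>simp add: c_def\<close>)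
  also have "(ellE c - (1 - c\<^sup>2) * ellK c) / (c * (1 - c\<^sup>2)) * (- k / c) = - (ellE c - k\<^sup>2 * ellK c) / (k * c\<^sup>2)"
    unfolding c2 using c k by (simp add: field_simps power2_eq_square)
  finally show "((\<lambda>k. ellK (compl_modulus k)) has_field_derivative
        - (ellE (compl_modulus k) - k\<^sup>2 * ellK (compl_modulus k)) / (k * (1 - k\<^sup>2))) (at k)"
    unfolding c_def compl_modulus_square [OF k] .
  have "((\<lambda>k. ellE (compl_modulus k)) has_field_derivative (ellE c - ellK c) / c * (- k / c)) (at k)"
    by (rule DERIV_chain2 [OF _ D]) (use ellE_has_field_derivative [OF c(1,2)] in \<open>simp add: c_def\<close>)
  also have "(ellE c - ellK c) / c * (- k / c) = - k * (ellE c - ellK c) / c\<^sup>2"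
    by (simp add: power2_eq_square)
  finally show "((\<lambda>k. ellE (compl_modulus k)) has_field_derivative
        - k * (ellE (compl_modulus k) - ellK (compl_modulus k)) / (1 - k\<^sup>2)) (at k)"
    unfolding c_def compl_modulus_square [OF k] .
qed

text \<open>The derivative vanishes identically, so the expression is constant, and the constant is
  found as k tends to 0. Grouping K - E together before multiplying by K' makes both products
  converge: K - E is O(k^2) while K' is O(1/k).\<close>

lemma legendre_relation:
  assumes k: "0 < k" "k < 1"
  shows "ellE (compl_modulus k) * ellK k - (ellK k - ellE k) * ellK (compl_modulus k) = pi / 2"
proof -
  define L where "L k = ellE (compl_modulus k) * ellK k - (ellK k - ellE k) * ellK (compl_modulus k)" for k
  have D: "(L has_field_derivative 0) (at k within {0<..<1})" if k: "k \<in> {0<..<1}" for k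
  proof -
    have k: "0 < k" "k < 1" using that by auto
    have k2: "1 - k\<^sup>2 > 0" using k by (simp add: power_less_one_iff)
    have K: "(ellE k - (1 - k\<^sup>2) * ellK k) / (k * (1 - k\<^sup>2)) = ellE k / (k * (1 - k\<^sup>2)) - ellK k / k"
      using k k2 by (simp add: diff_divide_distrib)
    have "(L has_field_derivative
       (- k * (ellE (compl_modulus k) - ellK (compl_modulus k)) / (1 - k\<^sup>2)) * ellK k
       + (ellE k - (1 - k\<^sup>2) * ellK k) / (k * (1 - k\<^sup>2)) * ellE (compl_modulus k)
       - (((ellE k - (1 - k\<^sup>2) * ellK k) / (k * (1 - k\<^sup>2)) - (ellE k - ellK k) / k) * ellK (compl_modulus k)
         + (- (ellE (compl_modulus k) - k\<^sup>2 * ellK (compl_modulus k)) / (k * (1 - k\<^sup>2))) * (ellK k - ellE k))) (at k)"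
      unfolding L_def [abs_def]
      by (intro DERIV_diff DERIV_mult ellK_has_field_derivative ellE_has_field_derivative
          ellK_compl_has_field_derivative ellE_compl_has_field_derivative k)
    moreover have "(- k * (e' - a') / c) * a + (e - c * a) / (k * c) * e'
       - (((e - c * a) / (k * c) - (e - a) / k) * a' + (- (e' - k\<^sup>2 * a') / (k * c)) * (a - e)) = 0"
      if c: "c > 0" "k\<^sup>2 = 1 - c" for a e a' e' c :: real
    proof -
      have "(- k * (e' - a') / c) * a + (e - c * a) / (k * c) * e'
       - (((e - c * a) / (k * c) - (e - a) / k) * a' + (- (e' - k\<^sup>2 * a') / (k * c)) * (a - e))
       = (- k\<^sup>2 * (e' - a') * a + (e - c * a) * e'
       - (((e - c * a) - c * (e - a)) * a' + (- (e' - k\<^sup>2 * a')) * (a - e))) / (k * c)"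
        using k c(1) by (simp add: field_simps power2_eq_square)
      also have "\<dots> = 0"
        unfolding c(2) by (simp add: algebra_simps)
      finally show ?thesis .
    qed
    ultimately have "(L has_field_derivative 0) (at k)"
      using k2 by simp
    then show ?thesis by (rule DERIV_subset) simp
  qed
  then obtain C where C: "\<And>k. k \<in> {0<..<1} \<Longrightarrow> L k = C"
    using has_field_derivative_zero_constant [of "{0<..<1}" L] D by auto
  \<comment> \<open>Both enclosures tend to pi / 2 at 0: there E' tends to 1 and K to pi / 2, and
    the second product is at most k (pi / 2)^2 / k'.\<close>
  let ?lo = "\<lambda>k. pi / 2 - k * (pi / 2)\<^sup>2 / sqrt (1 - k\<^sup>2)"
  let ?hi = "\<lambda>k. (1 + pi / 2 * k) * (pi / 2 / sqrt (1 - k\<^sup>2))"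
  have bounds: "?lo k \<le> L k \<and> L k \<le> ?hi k" if k: "k \<in> {0<..<1}" for k
  proof -
    have k: "0 < k" "k < 1" using that by auto
    note c = compl_modulus [OF k]
    define s where "s = sqrt (1 - k\<^sup>2)"
    have s: "compl_modulus k = s" "s > 0" using c(1) unfolding s_def compl_modulus_def by auto
    have 1: "pi / 2 \<le> ellK k" "ellK k \<le> pi / 2 / s"
      using ellK_bounds [OF k] s by auto
    have 2: "pi / 2 \<le> ellK s" "ellK s \<le> pi / 2 / k"
      using ellK_bounds [OF c(1,2)] s c by auto
    have 3: "1 \<le> ellE s" "ellE s \<le> 1 + pi / 2 * k"
      using ellE_bounds [OF c(1,2)] s c by auto
    have "0 \<le> (ellK k - ellE k) * ellK s"
      using ellK_minus_ellE_bounds [OF k] 2(1) by (intro mult_nonneg_nonneg) (auto intro: order_trans [of 0 "pi/2"])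
    moreover have "(ellK k - ellE k) * ellK s \<le> (k\<^sup>2 * (pi / 2 / s)) * (pi / 2 / k)"
    proof (intro mult_mono 2)
      show "ellK k - ellE k \<le> k\<^sup>2 * (pi / 2 / s)"
        using ellK_minus_ellE_bounds(2) [OF k] mult_left_mono [OF 1(2), of "k\<^sup>2"] by simp
    qed (use 2 s in \<open>auto intro: order_trans [of 0 "pi/2"]\<close>)
    moreover have "(k\<^sup>2 * (pi / 2 / s)) * (pi / 2 / k) = k * (pi / 2)\<^sup>2 / s"
      using k by (simp add: power2_eq_square)
    moreover have "1 * (pi / 2) \<le> ellE s * ellK k"
      using 1 3 by (intro mult_mono) auto
    moreover have "ellE s * ellK k \<le> (1 + pi / 2 * k) * (pi / 2 / s)"
      using 1 3 k by (intro mult_mono) (auto intro: order_trans [of 0 "pi/2"])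
    ultimately show ?thesis
      unfolding L_def s(1) s_def [symmetric] by linarith
  qed
  have ev: "eventually (\<lambda>k. k \<in> {0<..<1}) (at_right (0::real))"
    by (rule eventually_at_right_real) simp
  have "(L \<longlongrightarrow> pi / 2) (at_right 0)"
  proof (rule tendsto_sandwich)
    show "eventually (\<lambda>k. ?lo k \<le> L k) (at_right 0)" "eventually (\<lambda>k. L k \<le> ?hi k) (at_right 0)"
      using ev bounds by (auto elim: eventually_mono)
    have "(?lo \<longlongrightarrow> pi / 2 - 0 * (pi / 2)\<^sup>2 / sqrt (1 - 0\<^sup>2)) (at_right 0)"
      by (intro tendsto_intros) auto
    then show "(?lo \<longlongrightarrow> pi / 2) (at_right 0)" by simp
    have "(?hi \<longlongrightarrow> (1 + pi / 2 * 0) * (pi / 2 / sqrt (1 - 0\<^sup>2))) (at_right 0)"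
      by (intro tendsto_intros) auto
    then show "(?hi \<longlongrightarrow> pi / 2) (at_right 0)" by simp
  qed
  moreover have "(L \<longlongrightarrow> C) (at_right 0)"
    by (rule tendsto_eventually) (use ev C in \<open>auto elim: eventually_mono\<close>)
  ultimately have "C = pi / 2"
    using tendsto_unique trivial_limit_at_right_real by blast
  then show ?thesis
    using C [of k] k unfolding L_def by simp
qed

lemma ellK_pos: "0 < k \<Longrightarrow> k < 1 \<Longrightarrow> ellK k > 0"
  using ellK_bounds(1) [of k] pi_gt_zero by linarith

lemma ellK_ratio_has_field_derivative:
  assumes k: "0 < k" "k < 1"
  shows "((\<lambda>k. ellK (compl_modulus k) / ellK k) has_field_derivative
    - pi / (2 * k * (1 - k\<^sup>2) * (ellK k)\<^sup>2)) (at k)"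
proof -
  have k2: "1 - k\<^sup>2 > 0" using k by (simp add: power_less_one_iff)
  define a e a' e' c where "a = ellK k" and "e = ellE k" and "a' = ellK (compl_modulus k)"
    and "e' = ellE (compl_modulus k)" and "c = 1 - k\<^sup>2"
  have a: "a \<noteq> 0" unfolding a_def using ellK_pos [OF k] by simp
  have leg: "e' * a - (a - e) * a' = pi / 2"
    unfolding a_def e_def a'_def e'_def by (rule legendre_relation [OF k])
  have "((\<lambda>k. ellK (compl_modulus k) / ellK k) has_field_derivative
      (- (e' - k\<^sup>2 * a') / (k * c) * a - a' * ((e - c * a) / (k * c))) / (a * a)) (at k)"
    unfolding a_def e_def a'_def e'_def c_def
    by (intro DERIV_divide ellK_has_field_derivative ellK_compl_has_field_derivative k)
       (use ellK_pos [OF k] in simp)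
  moreover have "(- (e' - k\<^sup>2 * a') / (k * c) * a - a' * ((e - c * a) / (k * c))) / (a * a) =
      - pi / (2 * k * c * a\<^sup>2)"
  proof -
    have "- (e' - k\<^sup>2 * a') / (k * c) * a - a' * ((e - c * a) / (k * c)) =
        (- (e' - k\<^sup>2 * a') * a - a' * (e - c * a)) / (k * c)"
    proof -
      have "u / d * a - a' * (v / d) = (u * a - a' * v) / d" for u v d :: real
        by (simp add: diff_divide_distrib)
      then show ?thesis .
    qed
    \<comment> \<open>The numerator is minus the left-hand side of Legendre's relation.\<close>
    also have "- (e' - k\<^sup>2 * a') * a - a' * (e - c * a) = - (pi / 2)"
      unfolding leg [symmetric] c_def by (simp add: algebra_simps)
    finally show ?thesis by (simp add: power2_eq_square)
  qed
  ultimately show ?thesis unfolding a_def c_def by simp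
qed

lemma ellK_ratio_strict_antimono:
  assumes "0 < k" "k < l" "l < 1"
  shows "ellK (compl_modulus l) / ellK l < ellK (compl_modulus k) / ellK k"
proof (rule DERIV_neg_imp_decreasing [OF \<open>k < l\<close>])
  fix r assume "k \<le> r" "r \<le> l"
  then have r: "0 < r" "r < 1" using assms by auto
  then have "1 - r\<^sup>2 > 0" by (simp add: power_less_one_iff)
  then have "0 < 2 * r * (1 - r\<^sup>2) * (ellK r)\<^sup>2"
    using r ellK_pos [OF r] by simp
  then have "- pi / (2 * r * (1 - r\<^sup>2) * (ellK r)\<^sup>2) < 0"
    by (simp add: divide_neg_pos)
  then show "\<exists>y. ((\<lambda>k. ellK (compl_modulus k) / ellK k) has_real_derivative y) (at r) \<and> y < 0"
    using ellK_ratio_has_field_derivative [OF r] by blast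
qed

text \<open>This identifies a given k with the theta quotient of \<open>theta_modulus\<close>, which
  has the same ratio.\<close>

lemma ellK_ratio_inj:
  assumes "0 < k" "k < 1" "0 < l" "l < 1"
    and "ellK (compl_modulus k) / ellK k = ellK (compl_modulus l) / ellK l"
  shows "k = l"
  using assms ellK_ratio_strict_antimono [of k l] ellK_ratio_strict_antimono [of l k]
  by (cases k l rule: linorder_cases) auto

section \<open>Gauss's product and its logarithmic derivatives\<close>

text \<open>A finite form of Gauss's identity in the style of Shanks: divided by \<open>P n\<close>, the right-hand
  side is a partial sum of the \<open>q\<close>-binomial series.\<close>

lemma shanks_identity:
  fixes q :: real
  assumes q: "0 < q" "q < 1"
  defines "P \<equiv> \<lambda>n. \<Prod>k=1..n. (1 - q ^ k) / (1 + q ^ k)"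
  shows "1 + 2 * (\<Sum>j=1..n. (- 1) ^ j * q ^ (j\<^sup>2)) =
    (\<Sum>s\<le>n. (- 1) ^ s * (P n / P s) * (2 / (1 + q ^ s)) * q ^ (s * (n + 1)))"
proof -
  \<comment> \<open>In q-Pochhammer notation c s = (-1)^s (-1; q)_s / (q; q)_s, the coefficients of
    a q-binomial series.\<close>
  define c where "c s = (- 1) ^ s * (2 / ((1 + q ^ s) * P s))" for s :: nat
  have qp: "1 + q ^ k > 0" for k using q by (simp add: add_pos_pos)
  have qm: "1 - q ^ Suc k > 0" for k using q by (simp only: diff_gt_0_iff_gt power_Suc_less_one)
  have P_Suc: "P (Suc n) = P n * ((1 - q ^ Suc n) / (1 + q ^ Suc n))" for n
    by (simp add: P_def)
  have Pp: "P n > 0" for n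
    unfolding P_def using qp qm by (intro prod_pos) (metis Suc_le_D atLeastAtMost_iff divide_pos_pos One_nat_def)
  have c_Suc: "c (Suc s) * (1 - q ^ Suc s) = - c s * (1 + q ^ s)" for s
    unfolding c_def P_Suc using Pp [of s] qp [of s] qp [of "Suc s"] qm [of s] by (simp add: divide_simps)
  \<comment> \<open>The full series f(z) with coefficients c s satisfies (1 - z) f(q z) = (1 + z)
    f(z). This is that equation at z = q^n for partial sums, with the truncation error on the
    right.\<close>
  have tele: "(1 - q ^ n) * (\<Sum>s\<le>m. c s * q ^ (s * (n + 1))) - (1 + q ^ n) * (\<Sum>s\<le>m. c s * q ^ (s * n))
      = - (q ^ (Suc m * n) * c m * (1 + q ^ m))" for n m
  proof (induction m)
    case 0
    show ?case by (simp add: algebra_simps)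
  next
    case (Suc m)
    have "(1 - q ^ n) * (\<Sum>s\<le>Suc m. c s * q ^ (s * (n + 1))) - (1 + q ^ n) * (\<Sum>s\<le>Suc m. c s * q ^ (s * n))
        = - (q ^ (Suc m * n) * c m * (1 + q ^ m))
          + c (Suc m) * ((1 - q ^ n) * q ^ (Suc m * (n + 1)) - (1 + q ^ n) * q ^ (Suc m * n))"
      unfolding Suc.IH [symmetric] sum.atMost_Suc by (simp only: algebra_simps)
    also have "(1 - q ^ n) * q ^ (Suc m * (n + 1)) - (1 + q ^ n) * q ^ (Suc m * n)
        = - (q ^ (Suc m * n)) * (1 - q ^ Suc m) - q ^ (Suc (Suc m) * n) * (1 + q ^ Suc m)"
      by (simp add: algebra_simps power_add)
    also have "- (q ^ (Suc m * n) * c m * (1 + q ^ m)) + c (Suc m) *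
        (- (q ^ (Suc m * n)) * (1 - q ^ Suc m) - q ^ (Suc (Suc m) * n) * (1 + q ^ Suc m))
        = - (q ^ (Suc m * n)) * (c m * (1 + q ^ m) + c (Suc m) * (1 - q ^ Suc m))
          - q ^ (Suc (Suc m) * n) * c (Suc m) * (1 + q ^ Suc m)"
      by (simp only: algebra_simps)
    finally show ?case unfolding c_Suc by simp
  qed
  have "1 + 2 * (\<Sum>j=1..n. (- 1) ^ j * q ^ (j\<^sup>2)) = P n * (\<Sum>s\<le>n. c s * q ^ (s * (n + 1)))"
  proof (induction n)
    case 0
    show ?case by (simp add: c_def P_def)
  next
    case (Suc n)
    let ?N = "Suc n"
    define A where "A = (\<Sum>s\<le>?N. c s * q ^ (s * (?N + 1)))"
    define B where "B = (\<Sum>s\<le>n. c s * q ^ (s * ?N))"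
    \<comment> \<open>Truncating at m = n = N relates the sums for N and N - 1. The last term of the
      second sum and the truncation error combine into one multiple of c N (1 - q^N), which becomes
      the new theta term.\<close>
    have "(1 - q ^ ?N) * A - (1 + q ^ ?N) * (B + c ?N * q ^ (?N * ?N)) = - (q ^ (Suc ?N * ?N) * c ?N * (1 + q ^ ?N))"
      using tele [of ?N ?N] unfolding A_def B_def sum.atMost_Suc [of _ n] by simp
    then have "(1 - q ^ ?N) * A = (1 + q ^ ?N) * B + (1 + q ^ ?N) * (c ?N * (1 - q ^ ?N)) * q ^ (?N * ?N)"
      by (simp add: algebra_simps power_add)
    also have "c ?N * (1 - q ^ ?N) = (- 1) ^ ?N * 2 / P n"
      unfolding c_def P_Suc using Pp [of n] qp [of ?N] qm [of n] by (simp add: divide_simps)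
    finally have "P n * ((1 - q ^ ?N) * A) = (1 + q ^ ?N) * (P n * B + 2 * ((- 1) ^ ?N * q ^ (?N * ?N)))"
      using Pp [of n] by (simp add: field_simps)
    then have "P ?N * A = P n * B + 2 * ((- 1) ^ ?N * q ^ (?N * ?N))"
      unfolding P_Suc using qp [of ?N] by (simp add: field_simps)
    moreover have "P n * B = 1 + 2 * (\<Sum>j=1..n. (- 1) ^ j * q ^ (j\<^sup>2))"
      unfolding Suc.IH B_def by simp
    ultimately show ?case
      unfolding A_def [symmetric] by (simp add: power2_eq_square)
  qed
  also have "\<dots> = (\<Sum>s\<le>n. (- 1) ^ s * (P n / P s) * (2 / (1 + q ^ s)) * q ^ (s * (n + 1)))"
    unfolding sum_distrib_left c_def by (intro sum.cong) (simp_all add: mult_ac)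
  finally show ?thesis .
qed

text \<open>In the finite identity the term s = 0 is the partial product itself and each of the n
  other terms is at most 2 q^(n + 1) in modulus. Partial sums and partial products therefore differ
  by O(n q^n).\<close>

lemma gauss_identity:
  fixes q :: real
  assumes q: "0 < q" "q < 1" and lim: "(\<lambda>n. 1 + 2 * (\<Sum>j=1..n. (- 1) ^ j * q ^ (j\<^sup>2))) \<longlonglongrightarrow> \<theta>"
  shows "(\<lambda>n. \<Prod>k=1..n. (1 - q ^ k) / (1 + q ^ k)) \<longlonglongrightarrow> \<theta>"
proof -
  define P where "P n = (\<Prod>k=1..n. (1 - q ^ k) / (1 + q ^ k))" for n
  define F where "F n = 1 + 2 * (\<Sum>j=1..n. (- 1) ^ j * q ^ (j\<^sup>2))" for n
  define t where "t n s = (- 1) ^ s * (P n / P s) * (2 / (1 + q ^ s)) * q ^ (s * (n + 1))" for n s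
  have factor: "0 < (1 - q ^ k) / (1 + q ^ k) \<and> (1 - q ^ k) / (1 + q ^ k) \<le> 1" if "k \<ge> 1" for k
  proof -
    have "q ^ k < 1" "q ^ k > 0" using q that by (auto simp: power_less_one_iff)
    then show ?thesis by simp
  qed
  have Pp: "P n > 0" for n
    unfolding P_def using factor by (intro prod_pos) auto
  have "decseq P"
  proof (rule decseq_SucI)
    show "P (Suc n) \<le> P n" for n
      using mult_left_le [of "(1 - q ^ Suc n) / (1 + q ^ Suc n)" "P n"] factor [of "Suc n"] Pp [of n]
      by (simp add: P_def)
  qed
  have bound: "\<bar>F n - P n\<bar> \<le> 2 * q * (of_nat n * q ^ n)" for n
  proof -
    have P0: "P 0 = 1" by (simp add: P_def)
    have "F n = t n 0 + (\<Sum>s=1..n. t n s)"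
      unfolding F_def t_def P_def shanks_identity [OF q]
      by (simp add: atMost_atLeast0 sum.atLeast_Suc_atMost)
    moreover have "t n 0 = P n" by (simp add: t_def P0)
    ultimately have "\<bar>F n - P n\<bar> = \<bar>\<Sum>s=1..n. t n s\<bar>" by simp
    also have "\<dots> \<le> (\<Sum>s=1..n. \<bar>t n s\<bar>)" by (rule sum_abs)
    also have "\<dots> \<le> (\<Sum>s=1..n. 2 * q ^ (n + 1))"
    proof (rule sum_mono)
      fix s assume s: "s \<in> {1..n}"
      have "P n \<le> P s" using \<open>decseq P\<close> s by (auto dest: decseqD)
      then have "P n / P s \<le> 1" "P n / P s \<ge> 0" using Pp [of n] Pp [of s] by simp_all
      moreover have "2 / (1 + q ^ s) \<le> 2" "2 / (1 + q ^ s) \<ge> 0" using zero_less_power [OF q(1), of s] by (simp_all add: field_simps)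
      moreover have "q ^ (s * (n + 1)) \<le> q ^ (n + 1)" using q s mult_le_mono1 [of 1 s "n + 1"] by (intro power_decreasing) auto
      ultimately have "P n / P s * (2 / (1 + q ^ s)) * q ^ (s * (n + 1)) \<le> 1 * 2 * q ^ (n + 1)"
        using q by (intro mult_mono mult_nonneg_nonneg) auto
      moreover have "\<bar>t n s\<bar> = P n / P s * (2 / (1 + q ^ s)) * q ^ (s * (n + 1))"
        unfolding t_def abs_mult using Pp [of n] Pp [of s] q by (simp add: power_abs)
      ultimately show "\<bar>t n s\<bar> \<le> 2 * q ^ (n + 1)" by simp
    qed
    also have "\<dots> = 2 * q * (of_nat n * q ^ n)" by simp
    finally show ?thesis .
  qed
  have "(\<lambda>n. 2 * q * (of_nat n * q ^ n)) \<longlonglongrightarrow> 2 * q * 0"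
    using q by (intro tendsto_mult_left powser_times_n_limit_0) simp
  then have "(\<lambda>n. F n - P n) \<longlonglongrightarrow> 0"
    by (intro Lim_null_comparison [of "\<lambda>n. F n - P n"]) (use bound in auto)
  from tendsto_diff [OF lim [folded F_def] this] show ?thesis
    unfolding P_def by simp
qed

text \<open>An unconditional sum over the integers may be taken along symmetric intervals, where n
  and - n carry equal terms.\<close>

lemma theta4_partial_sums:
  assumes x: "x > 0"
  shows "(\<lambda>n. 1 + 2 * (\<Sum>j=1..n. (- 1) ^ j * exp (- pi * x) ^ (j\<^sup>2))) \<longlonglongrightarrow> theta4 x"
proof -
  let ?f = "\<lambda>n::int. (if even n then 1 else - 1) * exp (- pi * x * (of_int n)\<^sup>2)"
  have e: "exp (- pi * x) ^ (j\<^sup>2) = exp (- pi * x * (of_nat j)\<^sup>2)" for j :: nat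
    by (simp add: exp_of_nat_mult [symmetric] mult_ac)
  have "filterlim (\<lambda>n. - int n) at_bot sequentially"
    unfolding filterlim_at_bot
  proof
    fix Z :: int
    show "\<forall>\<^sub>F n in sequentially. - int n \<le> Z"
      using eventually_ge_at_top [of "nat (- Z)"] by eventually_elim auto
  qed
  then have "filterlim (\<lambda>n. {- int n..int n}) finite_sets_at_top sequentially"
    by (intro filterlim_atLeastAtMost_at_bot_at_top filterlim_int_sequentially) auto
  then have "(\<lambda>n. sum ?f {- int n..int n}) \<longlonglongrightarrow> theta4 x"
    using theta4_has_sum [OF x] unfolding has_sum_def by (rule filterlim_compose [rotated])
  moreover have "sum ?f {- int n..int n} = 1 + 2 * (\<Sum>j=1..n. (- 1) ^ j * exp (- pi * x) ^ (j\<^sup>2))" for n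
  proof (induction n)
    case (Suc n)
    have "{- int (Suc n)..int (Suc n)} = insert (int (Suc n)) (insert (- int (Suc n)) {- int n..int n})"
      by auto
    then have "sum ?f {- int (Suc n)..int (Suc n)} = ?f (int (Suc n)) + (?f (- int (Suc n)) + sum ?f {- int n..int n})"
      by simp
    also have "?f (int (Suc n)) = (- 1) ^ Suc n * exp (- pi * x) ^ ((Suc n)\<^sup>2)"
      unfolding e by (simp add: uminus_power_if)
    also have "?f (- int (Suc n)) = (- 1) ^ Suc n * exp (- pi * x) ^ ((Suc n)\<^sup>2)"
      unfolding e of_int_minus power2_minus by (simp add: uminus_power_if)
    finally show ?case unfolding Suc.IH by simp
  qed simp
  ultimately show ?thesis by simp
qed

section \<open>Majorants, power series and termwise differentiation\<close>

lemma sinh_lower_bound: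
  fixes y d :: real
  assumes "0 < d" "d \<le> y"
  shows "(1 - exp (- 2 * d)) / 2 * exp y \<le> sinh y"
proof -
  have "exp (- 2 * y) \<le> exp (- 2 * d)" using assms by simp
  then have "(1 - exp (- 2 * d)) * exp y \<le> (1 - exp (- 2 * y)) * exp y"
    by (intro mult_right_mono) auto
  also have "\<dots> = 2 * sinh y"
    by (simp add: sinh_field_def algebra_simps mult_exp_exp)
  finally show ?thesis by simp
qed

text \<open>Exponential majorants with a constant uniform in y >= d, as the Weierstrass test needs
  them: on that range sinh y >= exp y / M.\<close>

lemma inverse_sinh_bounds:
  fixes y d :: real
  assumes "0 < d" "d \<le> y"
  defines "M \<equiv> 2 / (1 - exp (- 2 * d))"
  shows "1 / sinh y \<le> M * exp (- y)" and "cosh y / (sinh y)\<^sup>2 \<le> M\<^sup>2 * exp (- y)"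
proof -
  have m: "1 - exp (- 2 * d) > 0" using assms by simp
  have s: "sinh y > 0" using assms by simp
  have le: "exp y / M \<le> sinh y"
    using sinh_lower_bound [OF assms(1,2)] by (simp add: M_def mult_ac)
  have M: "M > 0" unfolding M_def using m by simp
  have "1 / sinh y \<le> 1 / (exp y / M)"
    using le M s by (intro divide_left_mono mult_pos_pos) auto
  also have "\<dots> = M * exp (- y)" by (simp add: exp_minus field_simps)
  finally show 1: "1 / sinh y \<le> M * exp (- y)" .
  have "cosh y \<le> exp y"
    using assms by (simp add: cosh_field_def)
  then have "cosh y * ((1 / sinh y) * (1 / sinh y)) \<le> exp y * ((M * exp (- y)) * (M * exp (- y)))"
    using 1 s M by (intro mult_mono) auto
  also have "\<dots> = M\<^sup>2 * exp (- y)"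
    by (simp add: power2_eq_square exp_minus field_simps)
  finally show "cosh y / (sinh y)\<^sup>2 \<le> M\<^sup>2 * exp (- y)"
    by (simp add: power2_eq_square)
qed

text \<open>The squares are dominated by the coefficients (n + 1) (n + 2) of the second derivative
  of the geometric series, obtained from \<open>diffs\<close> applied twice.\<close>

lemma summable_Suc_square_powser:
  fixes r :: real
  assumes "0 \<le> r" "r < 1"
  shows "summable (\<lambda>n. (of_nat (Suc n))\<^sup>2 * r ^ n)"
proof -
  have "summable (\<lambda>n. diffs (diffs (\<lambda>_. 1)) n * r ^ n)"
    by (rule termdiff_converges [of _ 1], simp add: assms, rule termdiff_converges [of _ 1])
       (use assms in auto)
  then have "summable (\<lambda>n. 2 * (of_nat (Suc n) * of_nat (Suc (Suc n)) * r ^ n))"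
    by (simp add: diffs_def summable_mult)
  then show ?thesis
  proof (rule summable_comparison_test [rotated], intro exI allI impI)
    fix n :: nat
    have "(of_nat (Suc n))\<^sup>2 \<le> (2 * (of_nat (Suc n) * of_nat (Suc (Suc n))) :: real)"
      by (simp add: power2_eq_square algebra_simps)
    from mult_right_mono [OF this, of "r ^ n"]
    show "norm ((of_nat (Suc n))\<^sup>2 * r ^ n) \<le> 2 * (of_nat (Suc n) * of_nat (Suc (Suc n)) * r ^ n)"
      using assms by (simp add: abs_mult mult.assoc)
  qed
qed

lemma odd_powser_sums:
  fixes r :: real
  assumes "0 \<le> r" "r < 1"
  shows "(\<lambda>n. of_nat (2 * n + 1) * r ^ n) sums ((1 + r) / (1 - r)\<^sup>2)"
proof -
  have "(\<lambda>n. 2 * (of_nat (Suc n) * r ^ n) - r ^ n) sums (2 * (1 / (1 - r)\<^sup>2) - 1 / (1 - r))"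
    using geometric_deriv_sums [of r] assms by (intro sums_diff sums_mult geometric_sums) auto
  moreover have "2 * (1 / u\<^sup>2) - 1 / u = (1 + (1 - u)) / u\<^sup>2" if "u \<noteq> 0" for u :: real
    using that by (simp add: diff_divide_distrib power2_eq_square)
  from this [of "1 - r"] have "2 * (1 / (1 - r)\<^sup>2) - 1 / (1 - r) = (1 + r) / (1 - r)\<^sup>2"
    using assms by simp
  ultimately show ?thesis by (simp add: algebra_simps)
qed

text \<open>Multiplication by 1 - r replaces the squares by their differences (n + 1)^2 - n^2 = 2 n
  + 1, so the sum is the odd series divided by 1 - r.\<close>

lemma Suc_square_powser_sums:
  fixes r :: real
  assumes "0 \<le> r" "r < 1"
  shows "(\<lambda>n. (of_nat (Suc n))\<^sup>2 * r ^ n) sums ((1 + r) / (1 - r) ^ 3)"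
proof -
  define s where "s = (\<Sum>n. (of_nat (Suc n))\<^sup>2 * r ^ n)"
  have s: "(\<lambda>n. (of_nat (Suc n))\<^sup>2 * r ^ n) sums s"
    unfolding s_def using summable_Suc_square_powser [OF assms] by (rule summable_sums)
  have "(\<lambda>n. (of_nat (Suc n))\<^sup>2 * r ^ Suc n) sums (r * s)"
    using sums_mult [OF s, of r] by (simp add: mult_ac)
  then have "(\<lambda>n. (of_nat n)\<^sup>2 * r ^ n) sums (r * s)"
    by (subst (asm) sums_Suc_iff) simp
  from sums_diff [OF s this] have "(\<lambda>n. of_nat (2 * n + 1) * r ^ n) sums (s - r * s)"
    by (simp add: power2_eq_square algebra_simps)
  then have "s - r * s = (1 + r) / (1 - r)\<^sup>2"
    using odd_powser_sums [OF assms] by (rule sums_unique2)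
  then have "s * (1 - r) = (1 + r) / (1 - r)\<^sup>2" by (simp add: algebra_simps)
  then have "s = (1 + r) / (1 - r)\<^sup>2 / (1 - r)"
    using assms by (simp add: eq_divide_eq mult_ac)
  then have "s = (1 + r) / (1 - r) ^ 3"
    by (simp add: power2_eq_square power3_eq_cube mult.assoc)
  then show ?thesis using s by simp
qed

text \<open>The factors (1 - q^n) / (1 + q^n) of Gauss's product are written as tanh (pi n x / 2),
  whose logarithmic derivative in x is simply pi n / sinh (pi n x).\<close>

definition log_theta4 :: "real \<Rightarrow> real" where
  "log_theta4 x = (\<Sum>n. ln (tanh (pi * real (Suc n) * x / 2)))"

lemma tanh_nome:
  "tanh (pi * real n * x / 2) = (1 - exp (- pi * x) ^ n) / (1 + exp (- pi * x) ^ n)"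
proof -
  have "exp (- 2 * (pi * real n * x / 2)) = exp (- pi * x) ^ n"
    unfolding exp_of_nat_mult [symmetric] by (rule arg_cong [where f = exp]) simp
  then show ?thesis unfolding tanh_real_altdef by simp
qed

lemma summable_ln_tanh:
  assumes x: "x > 0"
  shows "summable (\<lambda>n. ln (tanh (pi * real (Suc n) * x / 2)))"
proof -
  define q where "q = exp (- pi * x)"
  have q: "0 < q" "q < 1" unfolding q_def using x by auto
  have "summable (\<lambda>n. 2 / (1 - q) * q ^ n)"
    using q by (intro summable_mult summable_geometric) auto
  then show ?thesis
  proof (rule summable_comparison_test [rotated], intro exI allI impI)
    fix n :: nat
    define p where "p = q ^ Suc n"
    have p: "0 < p" "p \<le> q" "p \<le> q ^ n"
      unfolding p_def using q by (auto simp: power_le_one mult_left_le)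
    have T: "tanh (pi * real (Suc n) * x / 2) = (1 - p) / (1 + p)"
      unfolding p_def q_def by (rule tanh_nome)
    have "ln ((1 + p) / (1 - p)) \<le> (1 + p) / (1 - p) - 1"
      using p q by (intro ln_le_minus_one) simp
    also have "\<dots> = 2 * p / (1 - p)" using p q by (simp add: field_simps)
    also have "\<dots> \<le> 2 * q ^ n / (1 - q)" using p q by (intro frac_le) auto
    finally have "ln ((1 + p) / (1 - p)) \<le> 2 / (1 - q) * q ^ n" by simp
    moreover have "ln ((1 - p) / (1 + p)) = - ln ((1 + p) / (1 - p))"
      using p q by (simp add: ln_div)
    moreover have "ln ((1 - p) / (1 + p)) \<le> 0"
      using p q by simp
    ultimately show "norm (ln (tanh (pi * real (Suc n) * x / 2))) \<le> 2 / (1 - q) * q ^ n"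
      unfolding T by simp
  qed
qed

lemma theta4_eq_exp:
  assumes x: "x > 0"
  shows "theta4 x = exp (log_theta4 x)"
proof -
  define q where "q = exp (- pi * x)"
  have q: "0 < q" "q < 1" unfolding q_def using x by auto
  let ?t = "\<lambda>n. tanh (pi * real (Suc n) * x / 2)"
  have t: "?t n > 0" for n using x by simp
  have T: "?t n = (1 - q ^ Suc n) / (1 + q ^ Suc n)" for n
    unfolding q_def by (rule tanh_nome)
  have "exp (\<Sum>k<n. ln (?t k)) = (\<Prod>k=1..n. (1 - q ^ k) / (1 + q ^ k))" for n
  proof -
    have "exp (\<Sum>k<n. ln (?t k)) = (\<Prod>k<n. ?t k)"
      unfolding exp_sum [OF finite_lessThan] exp_ln [OF t] ..
    also have "\<dots> = (\<Prod>k=1..n. (1 - q ^ k) / (1 + q ^ k))"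
      unfolding T prod.atLeast1_atMost_eq One_nat_def ..
    finally show ?thesis .
  qed
  moreover have "(\<lambda>n. exp (\<Sum>k<n. ln (?t k))) \<longlonglongrightarrow> exp (log_theta4 x)"
    unfolding log_theta4_def using summable_sums [OF summable_ln_tanh [OF x]]
    by (intro tendsto_exp) (simp add: sums_def)
  moreover have "(\<lambda>n. \<Prod>k=1..n. (1 - q ^ k) / (1 + q ^ k)) \<longlonglongrightarrow> theta4 x"
    using theta4_partial_sums [OF x] by (intro gauss_identity q) (simp add: q_def)
  ultimately show ?thesis using LIMSEQ_unique by auto
qed

lemma summable_square_exp:
  fixes d :: real
  assumes "d > 0"
  shows "summable (\<lambda>n. (real (Suc n))\<^sup>2 * exp (- d * real (Suc n)))"
proof -
  have "exp (- d * real (Suc n)) = exp (- d) * exp (- d) ^ n" for n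
    by (simp add: exp_of_nat_mult [symmetric] exp_add [symmetric] algebra_simps)
  then show ?thesis
    using summable_mult [OF summable_Suc_square_powser [of "exp (- d)"], of "exp (- d)"] assms
    by (simp add: mult_ac)
qed

lemma log_theta4_derivatives:
  assumes x: "x > 0"
  shows "(log_theta4 has_field_derivative (\<Sum>n. pi * real (Suc n) / sinh (pi * real (Suc n) * x))) (at x)"
    and "((\<lambda>x. \<Sum>n. pi * real (Suc n) / sinh (pi * real (Suc n) * x)) has_field_derivative
      - (pi\<^sup>2 * (\<Sum>n. (real (Suc n))\<^sup>2 * cosh (pi * real (Suc n) * x) / (sinh (pi * real (Suc n) * x))\<^sup>2))) (at x)"
    and summable_cosh_div_sinh_square:
      "summable (\<lambda>n. (real (Suc n))\<^sup>2 * cosh (pi * real (Suc n) * x) / (sinh (pi * real (Suc n) * x))\<^sup>2)"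
proof -
  define a where "a n = pi * real (Suc n)" for n
  define d where "d = pi * x / 2"
  \<comment> \<open>An open half-line around x that stays away from 0. On it a n * y >= d (n + 1),
    so the majorants are uniform.\<close>
  define S where "S = {x / 2<..}"
  define M where "M = 2 / (1 - exp (- 2 * d))"
  have a: "a n > 0" for n unfolding a_def by simp
  have d: "d > 0" unfolding d_def using x by simp
  have M: "M > 0" unfolding M_def using d by simp
  have S: "convex S" "x \<in> interior S" "x \<in> S"
    unfolding S_def using x by (auto simp: interior_open)
  have le: "d * real (Suc n) \<le> a n * y" if "y \<in> S" for n y
    using that x mult_left_mono [of "x / 2" y "pi * real (Suc n)"] unfolding a_def d_def S_def by (simp add: mult_ac)
  have le': "d \<le> a n * y" if "y \<in> S" for n y
  proof -
    have "d * 1 \<le> d * real (Suc n)" using d by (intro mult_left_mono) auto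
    then show ?thesis using le [OF that, of n] by linarith
  qed
  have y: "y > 0" if "y \<in> S" for y using that x unfolding S_def by simp
  \<comment> \<open>The square of n + 1 is larger than this bound requires; it lets one summable
    majorant serve both differentiations.\<close>
  have b1: "norm (a n / sinh (a n * y)) \<le> pi * M * ((real (Suc n))\<^sup>2 * exp (- d * real (Suc n)))" if "y \<in> S" for n y
  proof -
    have "1 / sinh (a n * y) \<le> M * exp (- (a n * y))"
      using inverse_sinh_bounds(1) [OF d le' [OF that]] unfolding M_def .
    also have "\<dots> \<le> M * exp (- d * real (Suc n))" using le [OF that, of n] M by simp
    finally have "a n * (1 / sinh (a n * y)) \<le> (pi * (real (Suc n))\<^sup>2) * (M * exp (- d * real (Suc n)))"
      using a [of n] y [OF that] by (intro mult_mono) (auto simp: a_def power2_eq_square)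
    then show ?thesis using a [of n] y [OF that] by (simp add: mult_ac)
  qed
  have b2: "norm (- (a n * a n * cosh (a n * y) / (sinh (a n * y))\<^sup>2)) \<le> pi\<^sup>2 * M\<^sup>2 * ((real (Suc n))\<^sup>2 * exp (- d * real (Suc n)))"
    if "y \<in> S" for n y
  proof -
    have "cosh (a n * y) / (sinh (a n * y))\<^sup>2 \<le> M\<^sup>2 * exp (- (a n * y))"
      using inverse_sinh_bounds(2) [OF d le' [OF that]] unfolding M_def .
    also have "\<dots> \<le> M\<^sup>2 * exp (- d * real (Suc n))" using le [OF that, of n] M by simp
    finally have "(a n * a n) * (cosh (a n * y) / (sinh (a n * y))\<^sup>2) \<le> (a n * a n) * (M\<^sup>2 * exp (- d * real (Suc n)))"
      using a [of n] by (intro mult_left_mono) auto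
    then show ?thesis using a [of n] by (simp add: a_def power2_eq_square mult_ac)
  qed
  have sm: "summable (\<lambda>n. C * ((real (Suc n))\<^sup>2 * exp (- d * real (Suc n))))" for C
    by (intro summable_mult summable_square_exp d)
  have D1: "((\<lambda>x. ln (tanh (a n * x / 2))) has_field_derivative a n / sinh (a n * y)) (at y within S)"
    if "y \<in> S" for n y
  proof -
    define z where "z = a n * y / 2"
    have z: "z > 0" unfolding z_def using a [of n] y [OF that] by simp
    have "((\<lambda>x. tanh (a n * x / 2)) has_field_derivative (1 - (tanh z)\<^sup>2) * (a n / 2)) (at y within S)"
      using z unfolding z_def by (auto intro!: derivative_eq_intros)
    then have "((\<lambda>x. ln (tanh (a n * x / 2))) has_field_derivative
        (1 - (tanh z)\<^sup>2) * (a n / 2) * (1 / tanh z)) (at y within S)"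
      using z unfolding z_def by (auto intro!: derivative_eq_intros)
    \<comment> \<open>(1 - tanh^2 z) / tanh z = 1 / (sinh z cosh z) = 2 / sinh (2 z), which removes
      the half in the argument.\<close>
    moreover have "(1 - (tanh z)\<^sup>2) * (a n / 2) * (1 / tanh z) = a n / sinh (2 * z)"
    proof -
      have "(1 - (tanh z)\<^sup>2) = 1 / (cosh z)\<^sup>2"
      proof -
        have "1 - s / c = 1 / c" if "c \<noteq> 0" "c - s = 1" for s c :: real
          using that by (simp add: field_simps)
        from this [of "(cosh z)\<^sup>2" "(sinh z)\<^sup>2"] show ?thesis
          by (simp add: tanh_def power_divide hyperbolic_pythagoras)
      qed
      then show ?thesis
        using z unfolding sinh_double by (simp add: tanh_def power2_eq_square)
    qed
    ultimately show ?thesis unfolding z_def by simp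
  qed
  have D2: "((\<lambda>x. a n / sinh (a n * x)) has_field_derivative - (a n * a n * cosh (a n * y) / (sinh (a n * y))\<^sup>2)) (at y within S)"
    if "y \<in> S" for n y
    using a [of n] y [OF that] by (auto intro!: derivative_eq_intros simp: power2_eq_square)
  have sl: "summable (\<lambda>n. ln (tanh (a n * x / 2)))"
    using summable_ln_tanh [OF x] unfolding a_def .
  have s1: "summable (\<lambda>n. a n / sinh (a n * x))"
    by (rule summable_comparison_test [OF _ sm]) (use b1 [OF S(3)] in blast)
  have s2: "summable (\<lambda>n. - (a n * a n * cosh (a n * x) / (sinh (a n * x))\<^sup>2))"
    by (rule summable_comparison_test [OF _ sm]) (use b2 [OF S(3)] in blast)
  show "(log_theta4 has_field_derivative (\<Sum>n. pi * real (Suc n) / sinh (pi * real (Suc n) * x))) (at x)"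
    unfolding log_theta4_def [abs_def] a_def [symmetric]
    by (rule has_field_derivative_series' [OF S(1) D1 Weierstrass_m_test' [OF b1 sm] S(3) sl S(2)])
  have eq: "- (a n * a n * cosh (a n * y) / (sinh (a n * y))\<^sup>2) =
     - (pi\<^sup>2) * ((real (Suc n))\<^sup>2 * cosh (a n * y) / (sinh (a n * y))\<^sup>2)" for n y
    by (simp add: a_def power2_eq_square)
  have s3: "summable (\<lambda>n. (real (Suc n))\<^sup>2 * cosh (a n * x) / (sinh (a n * x))\<^sup>2)"
    using summable_mult [OF s2 [unfolded eq], of "- 1 / pi\<^sup>2"] by simp
  show "summable (\<lambda>n. (real (Suc n))\<^sup>2 * cosh (pi * real (Suc n) * x) / (sinh (pi * real (Suc n) * x))\<^sup>2)"
    using s3 unfolding a_def .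
  have "((\<lambda>x. \<Sum>n. a n / sinh (a n * x)) has_field_derivative
      (\<Sum>n. - (a n * a n * cosh (a n * x) / (sinh (a n * x))\<^sup>2))) (at x)"
    by (rule has_field_derivative_series' [OF S(1) D2 Weierstrass_m_test' [OF b2 sm] S(3) s1 S(2)])
  moreover have "(\<Sum>n. - (a n * a n * cosh (a n * x) / (sinh (a n * x))\<^sup>2)) =
      - (pi\<^sup>2 * (\<Sum>n. (real (Suc n))\<^sup>2 * cosh (a n * x) / (sinh (a n * x))\<^sup>2))"
    unfolding eq suminf_mult [OF s3] by simp
  ultimately show "((\<lambda>x. \<Sum>n. pi * real (Suc n) / sinh (pi * real (Suc n) * x)) has_field_derivative
      - (pi\<^sup>2 * (\<Sum>n. (real (Suc n))\<^sup>2 * cosh (pi * real (Suc n) * x) / (sinh (pi * real (Suc n) * x))\<^sup>2))) (at x)"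
    unfolding a_def by simp
qed

section \<open>Equality of the two hyperbolic series\<close>

lemma cosh_div_sinh_powers:
  fixes y :: real
  assumes "y > 0"
  shows "cosh y / (sinh y)\<^sup>2 = 2 * exp (- y) * (1 + (exp (- y))\<^sup>2) / (1 - (exp (- y))\<^sup>2)\<^sup>2"
    and "cosh y / (sinh y) ^ 3 = 4 * (exp (- y))\<^sup>2 * (1 + (exp (- y))\<^sup>2) / (1 - (exp (- y))\<^sup>2) ^ 3"
proof -
  define p where "p = exp (- y)"
  have p: "p > 0" "exp y = 1 / p" unfolding p_def by (auto simp: exp_minus field_simps)
  have "p < 1" unfolding p_def using assms by simp
  then have p2: "1 - p\<^sup>2 \<noteq> 0" using p(1) by (simp add: power2_eq_1_iff)
  \<comment> \<open>In terms of p = exp (- y) both quotients are rational, and up to a monomial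
    factor they are the sums (1 + r) / (1 - r)^2 and (1 + r) / (1 - r)^3 at r = p^2.\<close>
  have c: "cosh y = (1 + p\<^sup>2) / (2 * p)" and s: "sinh y = (1 - p\<^sup>2) / (2 * p)"
    unfolding cosh_field_def sinh_field_def p_def [symmetric] p(2) using p(1)
    by (simp_all add: field_simps power2_eq_square)
  show "cosh y / (sinh y)\<^sup>2 = 2 * exp (- y) * (1 + (exp (- y))\<^sup>2) / (1 - (exp (- y))\<^sup>2)\<^sup>2"
    unfolding c s p_def [symmetric] power_divide power_mult_distrib using p(1) by (simp add: power2_eq_square)
  show "cosh y / (sinh y) ^ 3 = 4 * (exp (- y))\<^sup>2 * (1 + (exp (- y))\<^sup>2) / (1 - (exp (- y))\<^sup>2) ^ 3"
    unfolding c s p_def [symmetric] power_divide power_mult_distrib using p(1)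
    by (simp add: power2_eq_square power3_eq_cube)
qed

text \<open>Both series are the row and column sums of \<open>4 n\<^sup>2 (2m - 1) q\<^bsup>n(2m - 1)\<^esup>\<close> with
  \<open>q = exp (- pi x)\<close>.\<close>

lemma cosh_sinh_series_exchange:
  assumes x: "x > 0"
  defines "u \<equiv> \<lambda>n. real (Suc n)^2 * cosh (pi * real (Suc n) * x) / (sinh (pi * real (Suc n) * x))^2"
    and "v \<equiv> \<lambda>n. real (2*n+1) * cosh (pi * real (2*n+1) * x / 2) / (sinh (pi * real (2*n+1) * x / 2))^3"
  shows "summable v" "2 * suminf u = suminf v"
proof -
  define q where "q = exp (- pi * x)"
  have q: "0 < q" "q < 1" unfolding q_def using x by auto
  \<comment> \<open>The factor 4 makes the column sums exactly v; the row sums are then 2 u.\<close>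
  define F where "F n m = 4 * (real (Suc n))\<^sup>2 * real (2 * m + 1) * q ^ (Suc n * (2 * m + 1))" for n m
  have F0: "F n m \<ge> 0" for n m unfolding F_def using q by simp
  have row: "(F n has_sum (2 * u n)) UNIV" for n
  proof (rule sums_nonneg_imp_has_sum [OF _ F0])
    define p where "p = q ^ Suc n"
    have "0 < p" "p < 1" unfolding p_def using q power_Suc_less_one [of q n] by auto
    then have p: "0 \<le> p\<^sup>2" "p\<^sup>2 < 1" by (auto simp: power_less_one_iff)
    have e: "exp (- (pi * real (Suc n) * x)) = p"
      unfolding p_def q_def exp_of_nat_mult [symmetric] by (rule arg_cong [where f = exp]) simp
    have "(\<lambda>m. 4 * (real (Suc n))\<^sup>2 * p * (real (2 * m + 1) * (p\<^sup>2) ^ m)) sums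
        (4 * (real (Suc n))\<^sup>2 * p * ((1 + p\<^sup>2) / (1 - p\<^sup>2)\<^sup>2))"
      by (rule sums_mult [OF odd_powser_sums [OF p]])
    moreover have "4 * (real (Suc n))\<^sup>2 * p * (real (2 * m + 1) * (p\<^sup>2) ^ m) = F n m" for m
      unfolding F_def p_def power_mult [symmetric] power_add [symmetric]
      by (simp add: power_mult power_add mult_ac power2_eq_square power_mult_distrib)
    moreover have "4 * (real (Suc n))\<^sup>2 * p * ((1 + p\<^sup>2) / (1 - p\<^sup>2)\<^sup>2) = 2 * u n"
    proof -
      have "u n = (real (Suc n))\<^sup>2 * (cosh (pi * real (Suc n) * x) / (sinh (pi * real (Suc n) * x))\<^sup>2)"
        unfolding u_def by simp
      also have "cosh (pi * real (Suc n) * x) / (sinh (pi * real (Suc n) * x))\<^sup>2 = 2 * p * (1 + p\<^sup>2) / (1 - p\<^sup>2)\<^sup>2"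
        using cosh_div_sinh_powers(1) [of "pi * real (Suc n) * x"] x unfolding e by simp
      finally show ?thesis by simp
    qed
    ultimately show "F n sums (2 * u n)" by simp
  qed
  \<comment> \<open>The column is a power series in r = q^(2 m + 1) = exp (- y)^2 with y = pi (2 m +
    1) x / 2, which explains the halved argument in the second series.\<close>
  have col: "((\<lambda>n. F n m) has_sum v m) UNIV" for m
  proof (rule sums_nonneg_imp_has_sum [OF _ F0])
    define r where "r = q ^ (2 * m + 1)"
    have r: "0 \<le> r" "r < 1" unfolding r_def using q power_Suc_less_one [of q "2 * m"] by auto
    have e: "(exp (- (pi * real (2*m+1) * x / 2)))\<^sup>2 = r"
      unfolding r_def q_def exp_of_nat_mult [symmetric] exp_double [symmetric]
      by (rule arg_cong [where f = exp]) simp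
    have "(\<lambda>n. 4 * real (2 * m + 1) * r * ((real (Suc n))\<^sup>2 * r ^ n)) sums
        (4 * real (2 * m + 1) * r * ((1 + r) / (1 - r) ^ 3))"
      by (rule sums_mult [OF Suc_square_powser_sums [OF r]])
    moreover have "4 * real (2 * m + 1) * r * ((real (Suc n))\<^sup>2 * r ^ n) = F n m" for n
    proof -
      have eq: "r * r ^ n = q ^ (Suc n * (2 * m + 1))"
        unfolding r_def by (simp only: mult.commute [of "Suc n"] power_mult power_Suc)
      show ?thesis unfolding F_def eq [symmetric] by (simp only: mult_ac)
    qed
    moreover have "4 * real (2 * m + 1) * r * ((1 + r) / (1 - r) ^ 3) = v m"
    proof -
      have "v m = real (2*m+1) * (cosh (pi * real (2*m+1) * x / 2) / (sinh (pi * real (2*m+1) * x / 2))^3)"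
        unfolding v_def by simp
      also have "cosh (pi * real (2*m+1) * x / 2) / (sinh (pi * real (2*m+1) * x / 2))^3 = 4 * r * (1 + r) / (1 - r) ^ 3"
        using cosh_div_sinh_powers(2) [of "pi * real (2*m+1) * x / 2"] x unfolding e by simp
      finally have "v m = real (2 * m + 1) * (4 * r * (1 + r) / (1 - r) ^ 3)" .
      then show ?thesis by (simp only: times_divide_eq_right mult_ac)
    qed
    ultimately show "(\<lambda>n. F n m) sums v m" by simp
  qed
  have u0: "u n \<ge> 0" for n unfolding u_def using x by simp
  have su: "(\<lambda>n. 2 * u n) summable_on UNIV"
  proof -
    have "summable (\<lambda>n. 2 * u n)"
      unfolding u_def using summable_cosh_div_sinh_square [OF x] by (rule summable_mult)
    then show ?thesis
      by (rule summable_nonneg_imp_summable_on) (simp add: u0)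
  qed
  \<comment> \<open>Nonnegative entries with summable row sums form an absolutely summable double
    family. This permits the interchange and also yields the summability of v.\<close>
  have "(\<lambda>p. norm (F (fst p) (snd p))) summable_on (UNIV \<times> UNIV)"
    unfolding Infinite_Sum.abs_summable_on_Sigma_iff fst_conv snd_conv
  proof (intro conjI ballI)
    show "(\<lambda>m. norm (F n m)) summable_on UNIV" for n
      using has_sum_imp_summable [OF row [of n]] F0 by simp
    show "(\<lambda>n. norm (\<Sum>\<^sub>\<infinity>m. norm (F n m))) summable_on UNIV"
      using su infsumI [OF row] F0 u0 by simp
  qed
  then have S: "(\<lambda>(n, m). F n m) summable_on (UNIV \<times> UNIV)"
    using Infinite_Sum.abs_summable_summable [of "\<lambda>p. F (fst p) (snd p)"] by (simp add: case_prod_unfold)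
  then have S': "(\<lambda>(m, n). F n m) summable_on (UNIV \<times> UNIV)"
    by (subst (asm) summable_on_reindex_bij_betw [of prod.swap "UNIV \<times> UNIV" "UNIV \<times> UNIV", symmetric])
       (auto simp: case_prod_unfold bij_betw_def)
  have "v summable_on UNIV"
    using summable_on_Sigma_banach [OF S'] infsumI [OF col] by simp
  then show "summable v" by (rule summable_on_imp_summable)
  have "(\<Sum>\<^sub>\<infinity>n. 2 * u n) = (\<Sum>\<^sub>\<infinity>m. v m)"
    using infsum_swap_banach [OF S] infsumI [OF row] infsumI [OF col] by simp
  moreover have "(\<Sum>\<^sub>\<infinity>n. 2 * u n) = (\<Sum>n. 2 * u n)"
    using has_sum_imp_sums [OF has_sum_infsum [OF su]] sums_unique by blast
  moreover have "(\<Sum>\<^sub>\<infinity>m. v m) = suminf v"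
    using has_sum_imp_sums [OF has_sum_infsum [OF \<open>v summable_on UNIV\<close>]] sums_unique by blast
  moreover have "(\<Sum>n. 2 * u n) = 2 * suminf u"
    unfolding u_def using summable_cosh_div_sinh_square [OF x] by (rule suminf_mult)
  ultimately show "2 * suminf u = suminf v" by simp
qed

section \<open>Theta functions and elliptic integrals\<close>

lemma nome_tendsto_0: "((\<lambda>x. exp (- pi * x)) \<longlongrightarrow> 0) at_top"
  by (intro filterlim_compose [OF exp_at_bot] filterlim_tendsto_neg_mult_at_bot
      [OF tendsto_const _ filterlim_ident]) simp

lemma theta2_rescale: "theta2 x = exp (- pi * x / 4) * (theta2 x * exp (pi * x / 4))"
  by (simp add: exp_minus field_simps)

text \<open>Besides the limits themselves, the rate at which \<open>theta2\<close> decays is needed: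
  it determines the logarithm in \<open>ellJ_thA_thB\<close>.\<close>

lemma theta_limits:
  shows theta3_tendsto: "(theta3 \<longlongrightarrow> 1) at_top"
    and theta2_scaled_tendsto: "((\<lambda>x. theta2 x * exp (pi * x / 4)) \<longlongrightarrow> 2) at_top"
    and theta2_tendsto: "(theta2 \<longlongrightarrow> 0) at_top"
proof -
  have ev: "eventually (\<lambda>x. x > 0) (at_top :: real filter)"
    by (rule eventually_gt_at_top)
  show "(theta3 \<longlongrightarrow> 1) at_top"
  proof (rule tendsto_sandwich [OF _ _ tendsto_const])
    show "eventually (\<lambda>x. 1 \<le> theta3 x) at_top"
      by (rule eventually_mono [OF ev theta3_ge_1])
    show "eventually (\<lambda>x. theta3 x \<le> (1 + exp (- pi * x)) / (1 - exp (- pi * x))) at_top"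
      by (rule eventually_mono [OF ev theta3_le])
    have "((\<lambda>x. (1 + exp (- pi * x)) / (1 - exp (- pi * x))) \<longlongrightarrow> (1 + 0) / (1 - 0)) at_top"
      by (intro tendsto_intros nome_tendsto_0) simp
    then show "((\<lambda>x. (1 + exp (- pi * x)) / (1 - exp (- pi * x))) \<longlongrightarrow> 1) at_top" by simp
  qed
  show 2: "((\<lambda>x. theta2 x * exp (pi * x / 4)) \<longlongrightarrow> 2) at_top"
  proof (rule tendsto_sandwich [OF _ _ tendsto_const])
    have e: "2 * exp (- pi * x / 4) * exp (pi * x / 4) = 2" for x :: real
      by (simp add: mult.assoc mult_exp_exp)
    have *: "2 \<le> theta2 x * exp (pi * x / 4) \<and> theta2 x * exp (pi * x / 4) \<le> 2 / (1 - exp (- pi * x))"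
      if "x > 0" for x
      using mult_right_mono [OF theta2_ge [OF that], of "exp (pi * x / 4)"]
        mult_right_mono [OF theta2_le [OF that], of "exp (pi * x / 4)"]
      unfolding e times_divide_eq_left by simp
    show "eventually (\<lambda>x. 2 \<le> theta2 x * exp (pi * x / 4)) at_top"
      by (rule eventually_mono [OF ev * [THEN conjunct1]])
    show "eventually (\<lambda>x. theta2 x * exp (pi * x / 4) \<le> 2 / (1 - exp (- pi * x))) at_top"
      by (rule eventually_mono [OF ev * [THEN conjunct2]])
    have "((\<lambda>x. 2 / (1 - exp (- pi * x))) \<longlongrightarrow> 2 / (1 - 0)) at_top"
      by (intro tendsto_intros nome_tendsto_0) simp
    then show "((\<lambda>x. 2 / (1 - exp (- pi * x))) \<longlongrightarrow> 2) at_top" by simp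
  qed
  have "((\<lambda>x. exp (- pi / 4 * x)) \<longlongrightarrow> 0) at_top"
    by (intro filterlim_compose [OF exp_at_bot] filterlim_tendsto_neg_mult_at_bot
        [OF tendsto_const _ filterlim_ident]) simp
  from tendsto_mult [OF this 2] show "(theta2 \<longlongrightarrow> 0) at_top"
    by (subst theta2_rescale [abs_def]) simp
qed

text \<open>The mean iteration acts on squares of theta constants. In these variables the modulus is
  B / A and the complementary modulus C / A.\<close>

definition thA :: "real \<Rightarrow> real" where "thA x = (theta3 x)\<^sup>2"
definition thB :: "real \<Rightarrow> real" where "thB x = (theta2 x)\<^sup>2"
definition thC :: "real \<Rightarrow> real" where "thC x = (theta4 x)\<^sup>2"

lemma th_limits:
  shows thA_tendsto: "(thA \<longlongrightarrow> 1) at_top" and thB_tendsto: "(thB \<longlongrightarrow> 0) at_top"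
  unfolding thA_def [abs_def] thB_def [abs_def]
  using tendsto_power [OF theta3_tendsto, of 2] tendsto_power [OF theta2_tendsto, of 2] by simp_all

context
  fixes x :: real
  assumes x: "x > 0"
begin

lemma th_recurrences:
  shows thA_rec: "thA x = thA (2 * x) + thB (2 * x)"
    and thC_rec: "thC x = thA (2 * x) - thB (2 * x)"
    and thB_rec: "(thB x)\<^sup>2 = 4 * thA (2 * x) * thB (2 * x)"
  unfolding thA_def thB_def thC_def theta3_square [OF x] theta4_square [OF x] theta2_square [OF x]
  by (simp_all add: power_mult_distrib mult_ac)

text \<open>That \<open>theta4\<close> does not vanish is invisible in its alternating series; it
  comes from Gauss's product.\<close>

lemma th_pos: "thA x > 0" "thB x > 0" "thC x > 0"
proof -
  have "theta3 x > 0" using theta3_ge_1 [OF x] by simp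
  then show "thA x > 0" unfolding thA_def by simp
  have "theta2 x > 0" using theta2_ge [OF x] by (rule less_le_trans [rotated]) simp
  then show "thB x > 0" unfolding thB_def by simp
  show "thC x > 0" unfolding thC_def theta4_eq_exp [OF x] by simp
qed

text \<open>Jacobi's identity between fourth powers of theta constants. With A and B taken at 2 x it
  is (A - B)^2 = (A + B)^2 - 4 A B.\<close>

lemma th_pythagoras: "(thC x)\<^sup>2 = (thA x)\<^sup>2 - (thB x)\<^sup>2"
  unfolding thB_rec thA_rec thC_rec by (simp add: power2_eq_square algebra_simps)

end

lemma ellJ_thA_thC_double:
  assumes x: "x > 0"
  shows "ellJ (thA (2 * x)) (thC (2 * x)) = ellJ (thA x) (thC x)"
proof -
  have x2: "2 * x > 0" using x by simp
  have "(thA x + thC x) / 2 = thA (2 * x)"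
    unfolding thA_rec [OF x] thC_rec [OF x] by simp
  moreover have "thA x * thC x = (thC (2 * x))\<^sup>2"
    unfolding thA_rec [OF x] thC_rec [OF x] th_pythagoras [OF x2] by (simp add: power2_eq_square algebra_simps)
  then have "sqrt (thA x * thC x) = thC (2 * x)"
    using th_pos(3) [OF x2] by simp
  ultimately show ?thesis
    using ellJ_agm [OF th_pos(1,3) [OF x]] by simp
qed

text \<open>A mean step from the pair at 2 x lands on half the pair at x, and the integral is
  homogeneous of degree - 1.\<close>

lemma ellJ_thA_thB_double:
  assumes x: "x > 0"
  shows "ellJ (thA (2 * x)) (thB (2 * x)) = 2 * ellJ (thA x) (thB x)"
proof -
  have x2: "2 * x > 0" using x by simp
  have e1: "(thA (2 * x) + thB (2 * x)) / 2 = 1 / 2 * thA x"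
    unfolding thA_rec [OF x] by simp
  have "thA (2 * x) * thB (2 * x) = (1 / 2 * thB x)\<^sup>2"
    unfolding power_mult_distrib thB_rec [OF x] by (simp add: power2_eq_square)
  then have e2: "sqrt (thA (2 * x) * thB (2 * x)) = 1 / 2 * thB x"
    using th_pos(2) [OF x] by simp
  have "ellJ (thA (2 * x)) (thB (2 * x)) = ellJ (1 / 2 * thA x) (1 / 2 * thB x)"
    using ellJ_agm [OF th_pos(1,2) [OF x2]] unfolding e1 e2 by (rule sym)
  also have "\<dots> = 2 * ellJ (thA x) (thB x)"
    by (subst ellJ_scale) (use th_pos [OF x] in auto)
  finally show ?thesis .
qed

lemma filterlim_doubling:
  assumes "x > 0"
  shows "filterlim (\<lambda>n. 2 ^ n * x :: real) at_top sequentially"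
proof -
  have "filterlim (\<lambda>n. 2 ^ n :: real) at_top sequentially"
    by (rule filterlim_at_top_mono [OF filterlim_real_sequentially])
       (auto intro!: always_eventually less_imp_le of_nat_less_two_power)
  then show ?thesis
    by (rule filterlim_at_top_mult_tendsto_pos [OF tendsto_const assms])
qed

text \<open>By monotonicity the integral lies between its values pi / (2 A) and pi / (2 C) at equal
  parameters, and A and C both tend to 1. Invariance under doubling carries the limit back to
  x.\<close>

lemma ellJ_thA_thC:
  assumes x: "x > 0"
  shows "ellJ (thA x) (thC x) = pi / 2"
proof -
  have iter: "ellJ (thA (2 ^ n * x)) (thC (2 ^ n * x)) = ellJ (thA x) (thC x)" for n
  proof (induction n)
    case (Suc n)
    have "2 ^ n * x > 0" using x by simp
    from ellJ_thA_thC_double [OF this] Suc show ?case by (simp add: mult_ac)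
  qed simp
  have "((\<lambda>y. ellJ (thA y) (thC y)) \<longlongrightarrow> pi / 2) at_top"
  proof (rule tendsto_sandwich)
    have *: "pi / (2 * thA y) \<le> ellJ (thA y) (thC y) \<and> ellJ (thA y) (thC y) \<le> pi / (2 * thC y)"
      if y: "y > 0" for y
    proof -
      have "2 * y > 0" using y by simp
      then have "thC y \<le> thA y"
        unfolding thA_rec [OF y] thC_rec [OF y] using th_pos(2) [of "2 * y"] by simp
      then show ?thesis
        using ellJ_antimono [of "thA y" "thA y" "thC y" "thA y"] ellJ_antimono [of "thC y" "thA y" "thC y" "thC y"]
          ellJ_same [of "thA y"] ellJ_same [of "thC y"] th_pos [OF y] by simp
    qed
    show "eventually (\<lambda>y. pi / (2 * thA y) \<le> ellJ (thA y) (thC y)) at_top"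
      by (rule eventually_mono [OF eventually_gt_at_top * [THEN conjunct1]])
    show "eventually (\<lambda>y. ellJ (thA y) (thC y) \<le> pi / (2 * thC y)) at_top"
      by (rule eventually_mono [OF eventually_gt_at_top * [THEN conjunct2]])
    have "((\<lambda>y. pi / (2 * thA y)) \<longlongrightarrow> pi / (2 * 1)) at_top"
      by (intro tendsto_intros thA_tendsto) simp
    then show "((\<lambda>y. pi / (2 * thA y)) \<longlongrightarrow> pi / 2) at_top" by simp
    have double: "filterlim (\<lambda>y::real. 2 * y) at_top at_top"
      by (rule filterlim_tendsto_pos_mult_at_top [OF tendsto_const _ filterlim_ident]) simp
    have "((\<lambda>y. thA (2 * y) - thB (2 * y)) \<longlongrightarrow> 1 - 0) at_top"
      by (intro tendsto_diff filterlim_compose [OF thA_tendsto double] filterlim_compose [OF thB_tendsto double])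
    then have "(thC \<longlongrightarrow> 1 - 0) at_top"
      by (rule Lim_transform_eventually)
         (rule eventually_mono [OF eventually_gt_at_top thC_rec [symmetric]])
    then have "((\<lambda>y. pi / (2 * thC y)) \<longlongrightarrow> pi / (2 * (1 - 0))) at_top"
      by (intro tendsto_intros) simp_all
    then show "((\<lambda>y. pi / (2 * thC y)) \<longlongrightarrow> pi / 2) at_top" by simp
  qed
  from filterlim_compose [OF this filterlim_doubling [OF x]] show ?thesis
    unfolding iter by (simp add: LIMSEQ_const_iff)
qed

lemma ellJ_normalize:
  assumes "a > 0" "b > 0"
  shows "ellJ 1 (b / a) = a * ellJ a b"
  using ellJ_scale [of a 1 "b / a"] assms by simp

text \<open>The quotient of the integral by y is invariant under doubling y, so it equals its limit
  at infinity. After normalising the first parameter to 1, \<open>ellJ_log_bounds\<close> reduces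
  that limit to the one of \<open>l\<close>, the quotient arsinh (1 / b) / y.\<close>

lemma ellJ_thA_thB:
  assumes x: "x > 0"
  shows "ellJ (thA x) (thB x) = pi / 2 * x"
proof -
  have iter: "ellJ (thA (2 ^ n * x)) (thB (2 ^ n * x)) / (2 ^ n * x) = ellJ (thA x) (thB x) / x" for n
  proof (induction n)
    case (Suc n)
    have "2 ^ n * x > 0" using x by simp
    from ellJ_thA_thB_double [OF this] Suc show ?case by (simp add: mult_ac)
  qed simp
  define b where "b y = thB y / thA y" for y
  define D where "D y = theta2 y * exp (pi * y / 4)" for y
  define l where "l y = arsinh (1 / b y) / y" for y
  have ev: "eventually (\<lambda>y. y > 0) (at_top :: real filter)" by (rule eventually_gt_at_top)
  have b0: "(b \<longlongrightarrow> 0 / 1) at_top"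
    unfolding b_def [abs_def] by (intro tendsto_intros thA_tendsto thB_tendsto) simp
  have bp: "b y > 0" if "y > 0" for y
    unfolding b_def using th_pos [OF that] by simp
  have b1: "eventually (\<lambda>y. b y < 1) at_top"
    using order_tendstoD(2) [OF b0, of 1] by simp
  have lim_over: "((\<lambda>y. f y / y) \<longlongrightarrow> 0) at_top" if "(f \<longlongrightarrow> c) at_top" for f :: "real \<Rightarrow> real" and c
    using that filterlim_at_top_imp_at_infinity [OF filterlim_ident] by (rule tendsto_divide_0)
  have l: "(l \<longlongrightarrow> pi / 2) at_top"
  proof -
    have D: "(D \<longlongrightarrow> 2) at_top"
      unfolding D_def [abs_def] by (rule theta2_scaled_tendsto)
    \<comment> \<open>Writing B = exp (- pi y / 2) D^2 splits arsinh (1 / b) into pi y / 2 and this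
      convergent remainder, which division by y makes vanish.\<close>
    have "((\<lambda>y. ln (1 + sqrt (1 + (b y)\<^sup>2)) + ln (thA y) - 2 * ln (D y)) \<longlongrightarrow>
        ln (1 + sqrt (1 + (0 / 1)\<^sup>2)) + ln 1 - 2 * ln 2) at_top"
      by (intro tendsto_intros thA_tendsto b0 D) simp_all
    from tendsto_add [OF lim_over [OF this] tendsto_const [of "pi / 2"]]
    have lim: "((\<lambda>y. (ln (1 + sqrt (1 + (b y)\<^sup>2)) + ln (thA y) - 2 * ln (D y)) / y + pi / 2) \<longlongrightarrow> pi / 2) at_top"
      by simp
    have eq: "(ln (1 + sqrt (1 + (b y)\<^sup>2)) + ln (thA y) - 2 * ln (D y)) / y + pi / 2 = l y"
      if y: "y > 0" for y
    proof -
      have s: "1 + sqrt (1 + (b y)\<^sup>2) > 0" by (simp add: add_pos_nonneg)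
      have "theta2 y > 0" using theta2_ge [OF y] by (rule less_le_trans [rotated]) simp
      then have Dp: "D y > 0" unfolding D_def by simp
      have "(1 / b y)\<^sup>2 + 1 = (1 + (b y)\<^sup>2) / (b y)\<^sup>2"
        using bp [OF y] by (simp add: field_simps)
      then have sq: "sqrt ((1 / b y)\<^sup>2 + 1) = sqrt (1 + (b y)\<^sup>2) / b y"
        using bp [OF y] by (simp only: real_sqrt_divide real_sqrt_abs abs_of_pos)
      have "arsinh (1 / b y) = ln ((1 + sqrt (1 + (b y)\<^sup>2)) / b y)"
        unfolding arsinh_real_def sq by (simp add: add_divide_distrib)
      also have "\<dots> = ln (1 + sqrt (1 + (b y)\<^sup>2)) - ln (b y)"
        using s bp [OF y] by (simp add: ln_div)
      also have "ln (b y) = ln (thB y) - ln (thA y)"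
        unfolding b_def using th_pos [OF y] by (simp add: ln_div)
      also have "thB y = exp (- pi * y / 2) * (D y)\<^sup>2"
        unfolding thB_def D_def power_mult_distrib exp_double [symmetric] by (simp add: exp_minus field_simps)
      also have "ln (exp (- pi * y / 2) * (D y)\<^sup>2) = - pi * y / 2 + 2 * ln (D y)"
        using Dp by (simp add: ln_mult ln_realpow)
      finally have "arsinh (1 / b y) = (ln (1 + sqrt (1 + (b y)\<^sup>2)) + ln (thA y) - 2 * ln (D y)) + pi / 2 * y"
        by simp
      then show ?thesis
        unfolding l_def using y by (simp add: add_divide_distrib)
    qed
    show ?thesis
      by (rule Lim_transform_eventually [OF lim eventually_mono [OF ev eq]])
  qed
  have lim: "((\<lambda>y. ellJ (thA y) (thB y) / y) \<longlongrightarrow> pi / 2) at_top"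
  proof (rule tendsto_sandwich)
    have eq: "ellJ (thA y) (thB y) / y = ellJ 1 (b y) / y / thA y" if "y > 0" for y
      unfolding b_def ellJ_normalize [OF th_pos(1,2) [OF that]] using th_pos(1) [OF that] by simp
    have lower: "l y / thA y \<le> ellJ (thA y) (thB y) / y"
      and upper: "ellJ (thA y) (thB y) / y \<le> (l y / sqrt (1 - (b y)\<^sup>2) + pi / 2 / y) / thA y"
      if "y > 0" "b y < 1" for y
    proof -
      note J = ellJ_log_bounds [OF bp [OF that(1)] that(2)]
      show "l y / thA y \<le> ellJ (thA y) (thB y) / y"
        unfolding eq [OF that(1)] l_def using J(1) that th_pos [OF that(1)] by (intro divide_right_mono) auto
      have "ellJ 1 (b y) / y \<le> (arsinh (1 / b y) / sqrt (1 - (b y)\<^sup>2) + pi / 2) / y"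
        using J(2) that by (intro divide_right_mono) auto
      also have "\<dots> = l y / sqrt (1 - (b y)\<^sup>2) + pi / 2 / y"
        unfolding l_def by (simp add: add_divide_distrib mult.commute)
      finally show "ellJ (thA y) (thB y) / y \<le> (l y / sqrt (1 - (b y)\<^sup>2) + pi / 2 / y) / thA y"
        unfolding eq [OF that(1)] using th_pos [OF that(1)] by (intro divide_right_mono) auto
    qed
    have both: "eventually (\<lambda>y. y > 0 \<and> b y < 1) at_top"
      using ev b1 by (rule eventually_conj)
    show "eventually (\<lambda>y. l y / thA y \<le> ellJ (thA y) (thB y) / y) at_top"
      using both by (rule eventually_mono) (blast intro: lower)
    show "eventually (\<lambda>y. ellJ (thA y) (thB y) / y \<le> (l y / sqrt (1 - (b y)\<^sup>2) + pi / 2 / y) / thA y) at_top"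
      using both by (rule eventually_mono) (blast intro: upper)
    have "((\<lambda>y. l y / thA y) \<longlongrightarrow> pi / 2 / 1) at_top"
      by (intro tendsto_divide l thA_tendsto) simp
    then show "((\<lambda>y. l y / thA y) \<longlongrightarrow> pi / 2) at_top" by simp
    have "((\<lambda>y. (l y / sqrt (1 - (b y)\<^sup>2) + pi / 2 / y) / thA y) \<longlongrightarrow>
        (pi / 2 / sqrt (1 - (0 / 1)\<^sup>2) + 0) / 1) at_top"
      by (intro tendsto_divide tendsto_add l thA_tendsto tendsto_real_sqrt tendsto_diff tendsto_power b0
          tendsto_const lim_over [OF tendsto_const]) simp_all
    then show "((\<lambda>y. (l y / sqrt (1 - (b y)\<^sup>2) + pi / 2 / y) / thA y) \<longlongrightarrow> pi / 2) at_top" by simp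
  qed
  from filterlim_compose [OF this filterlim_doubling [OF x]] have "ellJ (thA x) (thB x) / x = pi / 2"
    unfolding iter by (simp add: LIMSEQ_const_iff)
  then show ?thesis using x by (simp add: field_simps)
qed

text \<open>Dividing the parameters by A turns the two evaluated integrals into K(k) = A pi / 2 and
  K(k') = A pi x / 2, whose ratio is x.\<close>

lemma theta_modulus:
  assumes x: "x > 0"
  defines "k \<equiv> thB x / thA x"
  shows "0 < k" "k < 1" "compl_modulus k = thC x / thA x" "ellK k = pi / 2 * thA x"
    and "ellK (compl_modulus k) / ellK k = x"
proof -
  note pos = th_pos [OF x]
  show k0: "0 < k" unfolding k_def using pos by simp
  have "(thB x)\<^sup>2 < (thA x)\<^sup>2"
    using th_pythagoras [OF x] zero_less_power [OF pos(3), of 2] by simp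
  then have "thB x < thA x"
    using pos by (intro power2_less_imp_less [of "thB x"]) auto
  then show k1: "k < 1" unfolding k_def using pos by simp
  have "1 - k\<^sup>2 = ((thA x)\<^sup>2 - (thB x)\<^sup>2) / (thA x)\<^sup>2"
    unfolding k_def power_divide using pos by (simp add: diff_divide_distrib)
  also have "\<dots> = (thC x / thA x)\<^sup>2"
    unfolding th_pythagoras [OF x, symmetric] power_divide ..
  finally show c: "compl_modulus k = thC x / thA x"
    unfolding compl_modulus_def using pos by simp
  show K: "ellK k = pi / 2 * thA x"
    unfolding ellK_eq_ellJ [OF k0 k1] c ellJ_normalize [OF pos(1,3)] ellJ_thA_thC [OF x] by simp
  note cm = compl_modulus [OF k0 k1]
  have "ellK (compl_modulus k) = thA x * (pi / 2 * x)"
    unfolding ellK_eq_ellJ [OF cm(1,2)] cm(4) unfolding k_def ellJ_normalize [OF pos(1,2)] ellJ_thA_thB [OF x] ..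
  then show "ellK (compl_modulus k) / ellK k = x"
    unfolding K using pos by simp
qed

lemma ellK_ratio_pos:
  assumes "0 < k" "k < 1"
  shows "ellK (compl_modulus k) / ellK k > 0"
  using ellK_pos [OF assms] ellK_pos [OF compl_modulus_pos [OF assms] compl_modulus_less_1 [OF assms]] by simp

section \<open>Closed forms by differentiation along the modulus\<close>

lemma log_theta4_ellK:
  assumes k: "0 < k" "k < 1"
  shows "log_theta4 (ellK (compl_modulus k) / ellK k) = ln (2 / pi * compl_modulus k * ellK k) / 2"
proof -
  define x where "x = ellK (compl_modulus k) / ellK k"
  have x: "x > 0" unfolding x_def by (rule ellK_ratio_pos [OF k])
  note t = theta_modulus [OF x]
  \<comment> \<open>The theta quotient at x and k itself have the same ratio, so they coincide; the
    formulas for the theta modulus thus hold for the given k.\<close>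
  have "k = thB x / thA x"
    by (rule ellK_ratio_inj [OF k t(1,2)]) (simp add: t(5) x_def [symmetric])
  with t have e: "compl_modulus k = thC x / thA x" "ellK k = pi / 2 * thA x" by auto
  have "2 / pi * compl_modulus k * ellK k = thC x"
    unfolding e using th_pos(1) [OF x] by simp
  also have "\<dots> = exp (2 * log_theta4 x)"
    unfolding thC_def theta4_eq_exp [OF x] exp_double ..
  finally have "2 / pi * compl_modulus k * ellK k = exp (2 * log_theta4 x)" .
  then show ?thesis unfolding x_def [symmetric] by simp
qed

text \<open>With c = k'^2, the logarithmic derivative of k' K is - k / c + (E - c K) / (k c K) = (E
  - K) / (k c K). Half of it must equal the series times the derivative - pi / (2 k c K^2) of the
  ratio.\<close>

lemma inverse_sinh_series:
  assumes k: "0 < k" "k < 1"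
  defines "x \<equiv> ellK (compl_modulus k) / ellK k"
  shows "(\<Sum>n. pi * real (Suc n) / sinh (pi * real (Suc n) * x)) = ellK k * (ellK k - ellE k) / pi"
proof -
  define S where "S x = (\<Sum>n. pi * real (Suc n) / sinh (pi * real (Suc n) * x))" for x
  define a e c where "a = ellK k" and "e = ellE k" and "c = 1 - k\<^sup>2"
  have x: "x > 0" unfolding x_def by (rule ellK_ratio_pos [OF k])
  have c: "c > 0" unfolding c_def using k by (simp add: power_less_one_iff)
  have a: "a > 0" unfolding a_def by (rule ellK_pos [OF k])
  have k': "compl_modulus k > 0" "(compl_modulus k)\<^sup>2 = c" unfolding c_def by (rule compl_modulus [OF k])+
  have "((\<lambda>k. log_theta4 (ellK (compl_modulus k) / ellK k)) has_field_derivative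
      S x * (- pi / (2 * k * c * a\<^sup>2))) (at k)"
    using log_theta4_derivatives(1) [OF x] unfolding S_def a_def c_def x_def
    by (rule DERIV_chain2 [OF _ ellK_ratio_has_field_derivative [OF k]])
  moreover have "((\<lambda>k. log_theta4 (ellK (compl_modulus k) / ellK k)) has_field_derivative
      (e - a) / (2 * k * c * a)) (at k)"
  \<comment> \<open>The closed form of \<open>log_theta4\<close> holds throughout the open interval
    of moduli, so both functions have the same derivative at k.\<close>
  proof (rule has_field_derivative_transform_within_open [where S = "{0<..<1}"])
    have "((\<lambda>k. 2 / pi * compl_modulus k * ellK k) has_field_derivative
        (2 / pi * (- k / compl_modulus k)) * a + (e - c * a) / (k * c) * (2 / pi * compl_modulus k)) (at k)"
      unfolding a_def e_def c_def
      by (intro DERIV_mult DERIV_cmult compl_modulus_has_field_derivative ellK_has_field_derivative k)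
    then have "((\<lambda>k. ln (2 / pi * compl_modulus k * ellK k)) has_field_derivative
        (1 / (2 / pi * compl_modulus k * a)) *
        ((2 / pi * (- k / compl_modulus k)) * a + (e - c * a) / (k * c) * (2 / pi * compl_modulus k))) (at k)"
      unfolding a_def
      by (rule DERIV_chain2 [where f = ln and g = "\<lambda>k. 2 / pi * compl_modulus k * ellK k", rotated])
         (rule DERIV_ln_divide, use k'(1) a in \<open>simp add: a_def\<close>)
    then have "((\<lambda>k. ln (2 / pi * compl_modulus k * ellK k) / 2) has_field_derivative
        ((2 / pi * (- k / compl_modulus k)) * a + (e - c * a) / (k * c) * (2 / pi * compl_modulus k))
          * (1 / (2 / pi * compl_modulus k * a)) / 2) (at k)"
      unfolding mult.commute [of _ "1 / _"] by (rule DERIV_cdivide)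
    moreover have "((2 / pi * (- k / s)) * a + (e - c * a) / (k * c) * (2 / pi * s)) * (1 / (2 / pi * s * a)) / 2
        = (e - a) / (2 * k * c * a)" if s: "s > 0" "s\<^sup>2 = c" for s
    proof -
      have "((2 / pi * (- k / s)) * a + (e - c * a) / (k * c) * (2 / pi * s)) * (1 / (2 / pi * s * a)) / 2
          = (- k / s\<^sup>2 + (e - c * a) / (k * c * a)) / 2"
      proof -
        have "(p * u * a + w * (p * s)) * (1 / (p * s * a)) = u / s + w / a" if "p > 0" for p u w :: real
          using that s(1) a by (simp add: field_simps)
        from this [of "2 / pi" "- k / s" "(e - c * a) / (k * c)"] show ?thesis
          by (simp add: power2_eq_square)
      qed
      also have "- k / s\<^sup>2 + (e - c * a) / (k * c * a) = (- (k\<^sup>2) * a + (e - c * a)) / (k * c * a)"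
        unfolding s(2) using k c a by (simp add: field_simps power2_eq_square)
      also have "- (k\<^sup>2) * a + (e - c * a) = e - a"
        unfolding c_def by (simp add: algebra_simps)
      finally show ?thesis by simp
    qed
    ultimately show "((\<lambda>k. ln (2 / pi * compl_modulus k * ellK k) / 2) has_field_derivative
        (e - a) / (2 * k * c * a)) (at k)"
      using k' by simp
  qed (use k in \<open>auto simp: log_theta4_ellK\<close>)
  ultimately have "S x * (- pi / (2 * k * c * a\<^sup>2)) = (e - a) / (2 * k * c * a)"
    by (rule DERIV_unique)
  then have "S x = a * (a - e) / pi"
    using k c a by (simp add: field_simps power2_eq_square)
  then show ?thesis unfolding S_def a_def e_def .
qed

text \<open>K (K - E) / pi has k-derivative (k^2 K^2 - (K - E)^2) / (pi k k'^2). The chain rule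
  gives pi^3 / (2 k k'^2 K^2) times the series, and the quotient of the two produces the constant 2
  / pi^4 and the factor K^2.\<close>

lemma cosh_div_sinh_square_series:
  assumes k: "0 < k" "k < 1"
  defines "x \<equiv> ellK (compl_modulus k) / ellK k"
  shows "(\<Sum>n. (real (Suc n))\<^sup>2 * cosh (pi * real (Suc n) * x) / (sinh (pi * real (Suc n) * x))\<^sup>2) =
    2 / pi ^ 4 * (ellK k)\<^sup>2 * (k\<^sup>2 * (ellK k)\<^sup>2 - (ellK k - ellE k)\<^sup>2)"
proof -
  define S where "S x = (\<Sum>n. pi * real (Suc n) / sinh (pi * real (Suc n) * x))" for x
  define T where "T = (\<Sum>n. (real (Suc n))\<^sup>2 * cosh (pi * real (Suc n) * x) / (sinh (pi * real (Suc n) * x))\<^sup>2)"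
  define a e c where "a = ellK k" and "e = ellE k" and "c = 1 - k\<^sup>2"
  have x: "x > 0" unfolding x_def by (rule ellK_ratio_pos [OF k])
  have c: "c > 0" unfolding c_def using k by (simp add: power_less_one_iff)
  have a: "a > 0" unfolding a_def by (rule ellK_pos [OF k])
  have "((\<lambda>k. S (ellK (compl_modulus k) / ellK k)) has_field_derivative
      - (pi\<^sup>2 * T) * (- pi / (2 * k * c * a\<^sup>2))) (at k)"
    using log_theta4_derivatives(2) [OF x] unfolding S_def T_def a_def c_def x_def
    by (rule DERIV_chain2 [OF _ ellK_ratio_has_field_derivative [OF k]])
  moreover have "((\<lambda>k. S (ellK (compl_modulus k) / ellK k)) has_field_derivative
      (k\<^sup>2 * a\<^sup>2 - (a - e)\<^sup>2) / (k * c) / pi) (at k)"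
  proof (rule has_field_derivative_transform_within_open [where S = "{0<..<1}"])
    have "((\<lambda>k. ellK k * (ellK k - ellE k) / pi) has_field_derivative
        ((e - c * a) / (k * c) * (a - e) + ((e - c * a) / (k * c) - (e - a) / k) * a) / pi) (at k)"
      unfolding a_def e_def c_def
      by (intro DERIV_cdivide DERIV_mult DERIV_diff ellK_has_field_derivative ellE_has_field_derivative k)
    moreover have "(e - c * a) / (k * c) * (a - e) + ((e - c * a) / (k * c) - (e - a) / k) * a
        = ((e - c * a) * (a - e) + ((e - c * a) - c * (e - a)) * a) / (k * c)"
      using k c by (simp add: field_simps)
    moreover have "(e - c * a) * (a - e) + ((e - c * a) - c * (e - a)) * a = k\<^sup>2 * a\<^sup>2 - (a - e)\<^sup>2"
      unfolding c_def by (simp add: algebra_simps power2_eq_square)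
    ultimately show "((\<lambda>k. ellK k * (ellK k - ellE k) / pi) has_field_derivative
        (k\<^sup>2 * a\<^sup>2 - (a - e)\<^sup>2) / (k * c) / pi) (at k)"
      by simp
  next
    fix y :: real assume "y \<in> {0<..<1}"
    then show "ellK y * (ellK y - ellE y) / pi = S (ellK (compl_modulus y) / ellK y)"
      unfolding S_def by (intro inverse_sinh_series [symmetric]) auto
  qed (use k in auto)
  ultimately have eq: "- (pi\<^sup>2 * T) * (- pi / (2 * k * c * a\<^sup>2)) = (k\<^sup>2 * a\<^sup>2 - (a - e)\<^sup>2) / (k * c) / pi"
    by (rule DERIV_unique)
  have "T = 2 / pi ^ 4 * a\<^sup>2 * R" if "- (pi\<^sup>2 * T) * (- pi / (2 * k * c * a\<^sup>2)) = R / (k * c) / pi" for R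
    using that k c a by (simp add: field_simps power2_eq_square power4_eq_xxxx)
  from this [OF eq] show ?thesis unfolding T_def a_def e_def .
qed

theorem theorem1:
  fixes x k :: real
  assumes "x > 0" and "0 < k" and "k < 1"
    and "x = ellK (compl_modulus k) / ellK k"
  shows "summable (\<lambda>n. real (Suc n)^2 * cosh (pi * real (Suc n) * x) / (sinh (pi * real (Suc n) * x))^2) \<and>
         summable (\<lambda>n. real (2*n+1) * cosh (pi * real (2*n+1) * x / 2) / (sinh (pi * real (2*n+1) * x / 2))^3) \<and>
         2 * (\<Sum>n. real (Suc n)^2 * cosh (pi * real (Suc n) * x) / (sinh (pi * real (Suc n) * x))^2)
         = (\<Sum>n. real (2*n+1) * cosh (pi * real (2*n+1) * x / 2) / (sinh (pi * real (2*n+1) * x / 2))^3) \<and>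
         (\<Sum>n. real (2*n+1) * cosh (pi * real (2*n+1) * x / 2) / (sinh (pi * real (2*n+1) * x / 2))^3)
         = 4 / pi^4 * (ellK k)^2 * (k^2 * (ellK k)^2 - (ellK k - ellE k)^2)"
proof (intro conjI)
  note exch = cosh_sinh_series_exchange [OF \<open>x > 0\<close>]
  show "summable (\<lambda>n. real (Suc n)^2 * cosh (pi * real (Suc n) * x) / (sinh (pi * real (Suc n) * x))^2)"
    by (rule summable_cosh_div_sinh_square [OF \<open>x > 0\<close>])
  show "summable (\<lambda>n. real (2*n+1) * cosh (pi * real (2*n+1) * x / 2) / (sinh (pi * real (2*n+1) * x / 2))^3)"
    by (rule exch(1))
  show "2 * (\<Sum>n. real (Suc n)^2 * cosh (pi * real (Suc n) * x) / (sinh (pi * real (Suc n) * x))^2)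
      = (\<Sum>n. real (2*n+1) * cosh (pi * real (2*n+1) * x / 2) / (sinh (pi * real (2*n+1) * x / 2))^3)"
    by (rule exch(2))
  then show "(\<Sum>n. real (2*n+1) * cosh (pi * real (2*n+1) * x / 2) / (sinh (pi * real (2*n+1) * x / 2))^3)
      = 4 / pi^4 * (ellK k)^2 * (k^2 * (ellK k)^2 - (ellK k - ellE k)^2)"
    using cosh_div_sinh_square_series [OF \<open>0 < k\<close> \<open>k < 1\<close>] \<open>x = _\<close> by simp
qed

end
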